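(* Let $G=(V,E)$ be a finite, connected, simple graph and let $\Gamma\subset \mathrm{Aut}(G)$ be a subgroup acting transitively on $V$. Then the function $\lambda_1:\Pi_G\to[-1,1]$ assumes a global minimum (over $\Pi_G$) at a matrix in $\Delta_\Gamma$. If moreover $G=\mathrm{Cay}(\Gamma,S)$ is the Cayley graph of a finite group $\Gamma$ with respect to a minimal symmetric set $S$ of generators (with $\Gamma$ acting on $G$ by left multiplication), then $$\lim_{n\to\infty}\lambda_1(P_{X_n})=1$$ for every sequence $X_n\in\Delta_\Gamma$ converging to the boundary $\partial\Delta_\Gamma$, and a global minimum of $\lambda_1$ is assumed at an interior point of $\Delta_\Gamma$.
   Context: Let $G=(V,E)$ be a finite simple graph, $V=\{1,\dots,n\}$, $n\ge 2$. $\Pi_G$ is the set of all symmetric stochastic matrices $P=(p_{ij})\in\mathbb{R}^{n\times n}$ with $p_{ij}=0$ whenever $i\ne j$ and $\{i,j\}\notin E$ (diagonal entries may be positive). The eigenvalues of $P\in\Pi_G$, counted with multiplicity, are $1=\lambda_0(P)\ge\lambda_1(P)\ge\dots\ge\lambda_{n-1}(P)\ge-1$; so $\lambda_1(P)$ is the second highest eigenvalue. For a vertex transitive $\Gamma\subset\mathrm{Aut}(G)$, two edges are equivalent if some $\gamma\in\Gamma$ maps one to the other. Let $[e_1],\dots,[e_N]$ be the equivalence classes and let $m_j$ (the multiplicity) be the number of edges of $[e_j]$ meeting at a given vertex. A matrix $P\in\Pi_G$ is $\Gamma$-invariant if $p_{\gamma i,\gamma j}=p_{ij}$ for all $\gamma\in\Gamma$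 and all $i,j$. The set of $\Gamma$-invariant matrices in $\Pi_G$ with vanishing main diagonal is identified with the simplex $$\Delta_\Gamma=\{(x_1,\dots,x_N)\in[0,1]^N\mid \textstyle\sum_j m_jx_j=1\},$$ where $X=(x_1,\dots,x_N)$ corresponds to $P_X=(p_{ij})$ with $p_{ij}=x_k$ if $\{i,j\}\in[e_k]$, and $p_{ij}=0$ if $i=j$ or $\{i,j\}\notin E$. Interior points of $\Delta_\Gamma$ are those with all $x_j>0$; the boundary $\partial\Delta_\Gamma$ consists of the points with some $x_j=0$; $X_n\to\partial\Delta_\Gamma$ means the distance from $X_n$ to $\partial\Delta_\Gamma$ tends to $0$. A finite symmetric generating set $S\subset\Gamma$ is minimal if for every $s\in S$ the set $S\setminus\{s,s^{-1}\}$ no longer generates $\Gamma$. $\mathrm{Cay}(\Gamma,S)$ has vertex set $\Gamma$, and $\gamma,\gamma'$ are joined by an edge iff $\gamma'=\gamma s$ for some $s\in S$. *)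

theory Defs
  imports "HOL-Analysis.Analysis" "HOL-Algebra.Generated_Groups"
begin

section \<open>Graphs and their automorphisms\<close>

text \<open>
  The vertex set is the whole of an arbitrary finite type \<open>'v\<close>; a graph on it is given by its
  set of edges.
\<close>

definition simple_graph :: "'v::finite set set \<Rightarrow> bool" where
  "simple_graph E \<longleftrightarrow> (\<forall>e\<in>E. card e = 2)"

definition connected_graph :: "'v::finite set set \<Rightarrow> bool" where
  "connected_graph E \<longleftrightarrow> (\<forall>i j. (i, j) \<in> {(k, l). {k, l} \<in> E}\<^sup>*)"

definition graph_aut_group :: "'v::finite set set \<Rightarrow> ('v \<Rightarrow> 'v) monoid" where
  "graph_aut_group E =
     \<lparr>carrier = {\<gamma>. bij \<gamma> \<and> (\<forall>i j. {\<gamma> i, \<gamma> j} \<in> E \<longleftrightarrow> {i, j} \<in> E)},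
      mult = (\<circ>), one = id\<rparr>"

definition vertex_transitive :: "('v \<Rightarrow> 'v) set \<Rightarrow> bool" where
  "vertex_transitive \<Gamma> \<longleftrightarrow> (\<forall>i j. \<exists>\<gamma>\<in>\<Gamma>. \<gamma> i = j)"

section \<open>Symmetric stochastic matrices and their eigenvalues\<close>

definition sym_stochastic :: "'v::finite set set \<Rightarrow> (real^'v^'v) set" where
  "sym_stochastic E =
     {P. transpose P = P \<and> (\<forall>i j. 0 \<le> P $ i $ j) \<and> (\<forall>i. (\<Sum>j\<in>UNIV. P $ i $ j) = 1) \<and>
         (\<forall>i j. i \<noteq> j \<and> {i, j} \<notin> E \<longrightarrow> P $ i $ j = 0)}"

definition charpoly :: "real^'v^'v \<Rightarrow> real poly" where
  "charpoly P = det (mat [:0, 1:] - map_matrix (\<lambda>a. [:a:]) P)"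

text \<open>
  The real eigenvalues with algebraic multiplicity, in decreasing order and indexed from 0.
  For symmetric matrices all \<open>CARD('v)\<close> eigenvalues are real, so the list has length \<open>CARD('v)\<close>.
\<close>

definition eigval :: "nat \<Rightarrow> real^'v^'v \<Rightarrow> real" where
  "eigval k P = rev (sorted_list_of_multiset (proots (charpoly P))) ! k"

section \<open>Equivalence classes of edges and the simplex of invariant matrices\<close>

definition edge_equiv :: "('v \<Rightarrow> 'v) set \<Rightarrow> 'v::finite set set \<Rightarrow> ('v set \<times> 'v set) set" where
  "edge_equiv \<Gamma> E = {(e, f). e \<in> E \<and> f \<in> E \<and> (\<exists>\<gamma>\<in>\<Gamma>. \<gamma> ` e = f)}"

definition edge_classes :: "('v \<Rightarrow> 'v) set \<Rightarrow> 'v::finite set set \<Rightarrow> 'v set set set" where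
  "edge_classes \<Gamma> E = E // edge_equiv \<Gamma> E"

text \<open>
  The number of edges of a class at a given vertex; it does not depend on the vertex if the
  group is transitive, see \<open>edge_multiplicity_eq\<close> below.
\<close>

definition edge_multiplicity :: "'v::finite set set \<Rightarrow> nat" where
  "edge_multiplicity c = (THE m. \<forall>i. card {e \<in> c. i \<in> e} = m)"

text \<open>
  The coordinates \<open>x\<^sub>1, \<dots>, x\<^sub>N\<close> are indexed by the edge classes themselves. As the number \<open>N\<close> of
  classes depends on \<open>\<Gamma>\<close>, the ambient Euclidean space is indexed by all sets of sets of vertices,
  and coordinates at indices that are not edge classes are required to vanish; this does not
  affect distances.
\<close>

definition weight_simplex :: "('v \<Rightarrow> 'v) set \<Rightarrow> 'v::finite set set \<Rightarrow> (real^('v set set)) set" where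
  "weight_simplex \<Gamma> E =
     {X. (\<forall>c\<in>edge_classes \<Gamma> E. X $ c \<in> {0..1}) \<and> (\<forall>c. c \<notin> edge_classes \<Gamma> E \<longrightarrow> X $ c = 0) \<and>
         (\<Sum>c\<in>edge_classes \<Gamma> E. real (edge_multiplicity c) * X $ c) = 1}"

definition weight_simplex_interior ::
    "('v \<Rightarrow> 'v) set \<Rightarrow> 'v::finite set set \<Rightarrow> (real^('v set set)) set" where
  "weight_simplex_interior \<Gamma> E = {X \<in> weight_simplex \<Gamma> E. \<forall>c\<in>edge_classes \<Gamma> E. 0 < X $ c}"

definition weight_simplex_boundary ::
    "('v \<Rightarrow> 'v) set \<Rightarrow> 'v::finite set set \<Rightarrow> (real^('v set set)) set" where
  "weight_simplex_boundary \<Gamma> E = {X \<in> weight_simplex \<Gamma> E. \<exists>c\<in>edge_classes \<Gamma> E. X $ c = 0}"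

definition matrix_of_point ::
    "('v \<Rightarrow> 'v) set \<Rightarrow> 'v::finite set set \<Rightarrow> real^('v set set) \<Rightarrow> real^'v^'v" where
  "matrix_of_point \<Gamma> E X =
     (\<chi> i j. if {i, j} \<in> E then X $ (edge_equiv \<Gamma> E `` {{i, j}}) else 0)"

text \<open>
  If there is only one edge class then the boundary is empty and no sequence converges to it;
  this has to be said explicitly because \<^const>\<open>infdist\<close> to the empty set is 0.
\<close>

definition converges_to_set :: "(nat \<Rightarrow> 'a::metric_space) \<Rightarrow> 'a set \<Rightarrow> bool" where
  "converges_to_set X B \<longleftrightarrow> B \<noteq> {} \<and> (\<lambda>n. infdist (X n) B) \<longlonglongrightarrow> 0"

section \<open>Cayley graphs\<close>

definition sym_generating_set :: "('v, 'b) monoid_scheme \<Rightarrow> 'v set \<Rightarrow> bool" where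
  "sym_generating_set A S \<longleftrightarrow>
     finite S \<and> S \<subseteq> carrier A \<and> (\<forall>s\<in>S. inv\<^bsub>A\<^esub> s \<in> S) \<and> generate A S = carrier A"

definition minimal_sym_generating_set :: "('v, 'b) monoid_scheme \<Rightarrow> 'v set \<Rightarrow> bool" where
  "minimal_sym_generating_set A S \<longleftrightarrow>
     sym_generating_set A S \<and> (\<forall>s\<in>S. generate A (S - {s, inv\<^bsub>A\<^esub> s}) \<noteq> carrier A)"

definition cayley_edges :: "('v, 'b) monoid_scheme \<Rightarrow> 'v set \<Rightarrow> 'v set set" where
  "cayley_edges A S = {{g, h} | g h. g \<in> carrier A \<and> h \<in> carrier A \<and> (\<exists>s\<in>S. h = g \<otimes>\<^bsub>A\<^esub> s)}"

definition left_multiplications :: "('v, 'b) monoid_scheme \<Rightarrow> ('v \<Rightarrow> 'v) set" where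
  "left_multiplications A = (\<lambda>g h. g \<otimes>\<^bsub>A\<^esub> h) ` carrier A"

section \<open>Multiplicities are well defined, and the simplex parametrises the invariant matrices\<close>

lemma graph_aut_subgroupD:
  assumes "subgroup \<Gamma> (graph_aut_group E)"
  shows "\<And>\<gamma>. \<gamma> \<in> \<Gamma> \<Longrightarrow> bij \<gamma>"
    and "\<And>\<gamma> i j. \<gamma> \<in> \<Gamma> \<Longrightarrow> {\<gamma> i, \<gamma> j} \<in> E \<longleftrightarrow> {i, j} \<in> E"
    and "id \<in> \<Gamma>"
    and "\<And>\<gamma> \<delta>. \<gamma> \<in> \<Gamma> \<Longrightarrow> \<delta> \<in> \<Gamma> \<Longrightarrow> \<gamma> \<circ> \<delta> \<in> \<Gamma>"
    and "\<And>\<gamma>. \<gamma> \<in> \<Gamma> \<Longrightarrow> \<exists>\<delta>\<in>\<Gamma>. \<delta> \<circ> \<gamma> = id \<and> \<gamma> \<circ> \<delta> = id"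
proof -
  let ?A = "graph_aut_group E"
  have sub: "\<Gamma> \<subseteq> carrier ?A" using assms by (rule subgroup.subset)
  then show bij: "\<And>\<gamma>. \<gamma> \<in> \<Gamma> \<Longrightarrow> bij \<gamma>"
    and "\<And>\<gamma> i j. \<gamma> \<in> \<Gamma> \<Longrightarrow> {\<gamma> i, \<gamma> j} \<in> E \<longleftrightarrow> {i, j} \<in> E"
    by (auto simp: graph_aut_group_def)
  show "id \<in> \<Gamma>"
    using subgroup.one_closed[OF assms] by (simp add: graph_aut_group_def)
  show "\<And>\<gamma> \<delta>. \<gamma> \<in> \<Gamma> \<Longrightarrow> \<delta> \<in> \<Gamma> \<Longrightarrow> \<gamma> \<circ> \<delta> \<in> \<Gamma>"
    using subgroup.m_closed[OF assms] by (simp add: graph_aut_group_def)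
  fix \<gamma> assume g: "\<gamma> \<in> \<Gamma>"
  have bg: "bij \<gamma>" using bij g .
  define \<delta> where "\<delta> = Hilbert_Choice.inv \<gamma>"
  have d1: "\<gamma> \<circ> \<delta> = id" "\<delta> \<circ> \<gamma> = id"
    using bg unfolding \<delta>_def by (simp_all add: bij_is_inj bij_is_surj flip: surj_iff)
  have bd: "bij \<delta>" using bg unfolding \<delta>_def by (rule bij_imp_bij_inv)
  have dd: "\<gamma> (\<delta> i) = i" for i using d1(1) by (metis comp_apply id_apply)
  have gg: "{\<gamma> i, \<gamma> j} \<in> E \<longleftrightarrow> {i, j} \<in> E" for i j
    using g sub by (auto simp: graph_aut_group_def)
  have "{\<delta> i, \<delta> j} \<in> E \<longleftrightarrow> {i, j} \<in> E" for i j
    using gg[of "\<delta> i" "\<delta> j"] by (simp add: dd)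
  then have dA: "\<delta> \<in> carrier ?A" using bd by (simp add: graph_aut_group_def)
  have "inv\<^bsub>?A\<^esub> \<gamma> \<in> \<Gamma>" by (rule subgroup.m_inv_closed[OF assms g])
  moreover have "inv\<^bsub>?A\<^esub> \<gamma> = \<delta>"
    unfolding m_inv_def
  proof (rule the_equality)
    show "\<delta> \<in> carrier ?A \<and> \<gamma> \<otimes>\<^bsub>?A\<^esub> \<delta> = \<one>\<^bsub>?A\<^esub> \<and> \<delta> \<otimes>\<^bsub>?A\<^esub> \<gamma> = \<one>\<^bsub>?A\<^esub>"
      using dA d1 by (simp add: graph_aut_group_def)
  next
    fix y assume "y \<in> carrier ?A \<and> \<gamma> \<otimes>\<^bsub>?A\<^esub> y = \<one>\<^bsub>?A\<^esub> \<and> y \<otimes>\<^bsub>?A\<^esub> \<gamma> = \<one>\<^bsub>?A\<^esub>"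
    then have "\<gamma> \<circ> y = id" by (simp add: graph_aut_group_def)
    then have "\<delta> \<circ> (\<gamma> \<circ> y) = \<delta>" by simp
    then show "y = \<delta>" using d1 by (metis comp_assoc id_comp)
  qed
  ultimately show "\<exists>\<delta>\<in>\<Gamma>. \<delta> \<circ> \<gamma> = id \<and> \<gamma> \<circ> \<delta> = id"
    using d1 by auto
qed

lemma simple_graph_edgeE:
  assumes "simple_graph E" "e \<in> E"
  obtains i j where "e = {i, j}" "i \<noteq> j"
  using assms by (auto simp: simple_graph_def card_2_iff)

lemma image_edge_mem:
  assumes "simple_graph E" "subgroup \<Gamma> (graph_aut_group E)" "\<gamma> \<in> \<Gamma>" "e \<in> E"
  shows "\<gamma> ` e \<in> E"
proof -
  obtain i j where "e = {i, j}" using simple_graph_edgeE[OF assms(1,4)] by blast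
  then show ?thesis using graph_aut_subgroupD(2)[OF assms(2,3), of i j] assms(4) by simp
qed

lemma equiv_edge_equiv:
  assumes "subgroup \<Gamma> (graph_aut_group E)"
  shows "equiv E (edge_equiv \<Gamma> E)"
proof (rule equivI)
  note D = graph_aut_subgroupD[OF assms]
  show "edge_equiv \<Gamma> E \<subseteq> E \<times> E" by (auto simp: edge_equiv_def)
  show "refl_on E (edge_equiv \<Gamma> E)"
    unfolding refl_on_def edge_equiv_def using D(3)
    by (auto intro!: bexI[of _ id])
  show "sym (edge_equiv \<Gamma> E)"
  proof (rule symI)
    fix e f assume "(e, f) \<in> edge_equiv \<Gamma> E"
    then obtain \<gamma> where g: "e \<in> E" "f \<in> E" "\<gamma> \<in> \<Gamma>" "\<gamma> ` e = f" by (auto simp: edge_equiv_def)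
    obtain \<delta> where d: "\<delta> \<in> \<Gamma>" "\<delta> \<circ> \<gamma> = id" using D(5)[OF g(3)] by auto
    have "\<delta> ` f = e" using d(2) g(4) by (metis image_comp image_id id_apply)
    then show "(f, e) \<in> edge_equiv \<Gamma> E" using g d by (auto simp: edge_equiv_def)
  qed
  show "trans (edge_equiv \<Gamma> E)"
  proof (rule transI)
    fix e f h assume "(e, f) \<in> edge_equiv \<Gamma> E" "(f, h) \<in> edge_equiv \<Gamma> E"
    then obtain \<gamma> \<delta> where g: "e \<in> E" "h \<in> E" "\<gamma> \<in> \<Gamma>" "\<delta> \<in> \<Gamma>" "\<delta> ` (\<gamma> ` e) = h"
      by (auto simp: edge_equiv_def)
    then have "(\<delta> \<circ> \<gamma>) ` e = h" by (simp only: image_comp)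
    then show "(e, h) \<in> edge_equiv \<Gamma> E"
      unfolding edge_equiv_def using g(1,2) D(4)[OF g(4,3)] by blast
  qed
qed

lemma edge_multiplicity_eq:
  assumes "simple_graph E" "subgroup \<Gamma> (graph_aut_group E)" "vertex_transitive \<Gamma>"
    and c: "c \<in> edge_classes \<Gamma> E"
  shows "card {e \<in> c. i \<in> e} = edge_multiplicity c"
proof -
  note D = graph_aut_subgroupD[OF assms(2)]
  note eq = equiv_edge_equiv[OF assms(2)]
  have cE: "c \<subseteq> E"
    using c eq unfolding edge_classes_def by (metis in_quotient_imp_subset)
  have closed: "\<gamma> ` e \<in> c" if "\<gamma> \<in> \<Gamma>" "e \<in> c" for \<gamma> e
  proof -
    have "(e, \<gamma> ` e) \<in> edge_equiv \<Gamma> E"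
      using that cE image_edge_mem[OF assms(1,2)] by (auto simp: edge_equiv_def)
    then show ?thesis
      using c that(2) eq unfolding edge_classes_def by (metis in_quotient_imp_closed)
  qed
  have le: "card {e \<in> c. i \<in> e} \<le> card {e \<in> c. j \<in> e}" for i j
  proof -
    obtain \<gamma> where g: "\<gamma> \<in> \<Gamma>" "\<gamma> i = j"
      using assms(3) by (auto simp: vertex_transitive_def)
    have "inj_on ((`) \<gamma>) {e \<in> c. i \<in> e}"
      using D(1)[OF g(1)] by (meson bij_is_inj inj_image_eq_iff inj_onI)
    moreover have "(`) \<gamma> ` {e \<in> c. i \<in> e} \<subseteq> {e \<in> c. j \<in> e}"
      using closed[OF g(1)] g(2) by auto
    ultimately show ?thesis by (intro card_inj_on_le[of "(`) \<gamma>"]) auto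
  qed
  have "\<forall>j. card {e \<in> c. j \<in> e} = card {e \<in> c. i \<in> e}" using le by (meson le_antisym)
  then have "edge_multiplicity c = card {e \<in> c. i \<in> e}"
    unfolding edge_multiplicity_def by (intro the_equality) auto
  then show ?thesis by simp
qed

lemma row_sum_matrix_of_point:
  assumes "simple_graph E" "subgroup \<Gamma> (graph_aut_group E)" "vertex_transitive \<Gamma>"
  shows "(\<Sum>j\<in>UNIV. matrix_of_point \<Gamma> E X $ i $ j) =
         (\<Sum>c\<in>edge_classes \<Gamma> E. real (edge_multiplicity c) * X $ c)"
proof -
  let ?R = "edge_equiv \<Gamma> E"
  note eq = equiv_edge_equiv[OF assms(2)]
  have "(\<Sum>j\<in>UNIV. matrix_of_point \<Gamma> E X $ i $ j) = (\<Sum>j\<in>{j. {i, j} \<in> E}. X $ (?R `` {{i, j}}))"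
    by (simp add: matrix_of_point_def sum.If_cases)
  also have "\<dots> = (\<Sum>e\<in>{e \<in> E. i \<in> e}. X $ (?R `` {e}))"
  proof (rule sum.reindex_bij_betw)
    show "bij_betw (\<lambda>j. {i, j}) {j. {i, j} \<in> E} {e \<in> E. i \<in> e}"
      unfolding bij_betw_def
    proof
      show "inj_on (\<lambda>j. {i, j}) {j. {i, j} \<in> E}"
        by (auto simp: inj_on_def doubleton_eq_iff)
      show "(\<lambda>j. {i, j}) ` {j. {i, j} \<in> E} = {e \<in> E. i \<in> e}"
      proof (intro equalityI subsetI)
        fix e assume e: "e \<in> {e \<in> E. i \<in> e}"
        then obtain k l where "e = {k, l}" using simple_graph_edgeE[OF assms(1)] by blast
        with e have "e = {i, l} \<or> e = {i, k}" by auto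
        then show "e \<in> (\<lambda>j. {i, j}) ` {j. {i, j} \<in> E}" using e by auto
      qed auto
    qed
  qed
  also have "\<dots> = (\<Sum>c\<in>edge_classes \<Gamma> E. \<Sum>e\<in>{e \<in> {e \<in> E. i \<in> e}. ?R `` {e} = c}. X $ (?R `` {e}))"
    by (rule sum.group[symmetric]) (auto simp: edge_classes_def intro: quotientI)
  also have "\<dots> = (\<Sum>c\<in>edge_classes \<Gamma> E. real (edge_multiplicity c) * X $ c)"
  proof (rule sum.cong[OF refl])
    fix c assume c: "c \<in> edge_classes \<Gamma> E"
    have "{e \<in> {e \<in> E. i \<in> e}. ?R `` {e} = c} = {e \<in> c. i \<in> e}"
    proof -
      obtain f where f: "f \<in> E" "c = ?R `` {f}"
        using c unfolding edge_classes_def by (auto elim: quotientE)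
      have "e \<in> E \<and> ?R `` {e} = c \<longleftrightarrow> e \<in> c" for e
      proof
        assume "e \<in> E \<and> ?R `` {e} = c"
        then show "e \<in> c" using equiv_class_self[OF eq] by blast
      next
        assume "e \<in> c"
        then have "(f, e) \<in> ?R" using f by simp
        then show "e \<in> E \<and> ?R `` {e} = c"
          using f equiv_class_eq[OF eq] by (auto simp: edge_equiv_def)
      qed
      then show ?thesis by auto
    qed
    moreover have "(\<Sum>e\<in>{e \<in> {e \<in> E. i \<in> e}. ?R `` {e} = c}. X $ (?R `` {e})) =
        (\<Sum>e\<in>{e \<in> {e \<in> E. i \<in> e}. ?R `` {e} = c}. X $ c)"
      by (rule sum.cong) auto
    ultimately show "(\<Sum>e\<in>{e \<in> {e \<in> E. i \<in> e}. ?R `` {e} = c}. X $ (?R `` {e})) =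
        real (edge_multiplicity c) * X $ c"
      using edge_multiplicity_eq[OF assms c, of i] by simp
  qed
  finally show ?thesis .
qed

lemma weight_simplex_bij_invariant_matrices:
  assumes "simple_graph E" "subgroup \<Gamma> (graph_aut_group E)" "vertex_transitive \<Gamma>"
  shows "bij_betw (matrix_of_point \<Gamma> E) (weight_simplex \<Gamma> E)
    {P \<in> sym_stochastic E. (\<forall>\<gamma>\<in>\<Gamma>. \<forall>i j. P $ \<gamma> i $ \<gamma> j = P $ i $ j) \<and> (\<forall>i. P $ i $ i = 0)}"
    (is "bij_betw ?M ?D ?I")
proof -
  let ?R = "edge_equiv \<Gamma> E"
  note D = graph_aut_subgroupD[OF assms(2)]
  note eq = equiv_edge_equiv[OF assms(2)]
  note row = row_sum_matrix_of_point[OF assms]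
  have noloop: "{i, i} \<notin> E" for i
    using assms(1) by (auto simp: simple_graph_def)
  have cls: "?R `` {{i, j}} \<in> edge_classes \<Gamma> E" if "{i, j} \<in> E" for i j
    using that by (auto simp: edge_classes_def intro: quotientI)
  have clsE: "\<exists>i j. {i, j} \<in> E \<and> c = ?R `` {{i, j}}" if c: "c \<in> edge_classes \<Gamma> E" for c
  proof -
    obtain e where e: "e \<in> E" "c = ?R `` {e}"
      using c unfolding edge_classes_def by (auto elim: quotientE)
    moreover obtain i j where "e = {i, j}" using simple_graph_edgeE[OF assms(1) e(1)] by blast
    ultimately show ?thesis by blast
  qed
  have "inj_on ?M ?D"
  proof (rule inj_onI)
    fix X Y assume X: "X \<in> ?D" and Y: "Y \<in> ?D" and XY: "?M X = ?M Y"
    show "X = Y"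
      unfolding vec_eq_iff
    proof (intro allI)
      fix c show "X $ c = Y $ c"
      proof (cases "c \<in> edge_classes \<Gamma> E")
        case True
        then obtain i j where ij: "{i, j} \<in> E" "c = ?R `` {{i, j}}" using clsE by blast
        have "?M X $ i $ j = ?M Y $ i $ j" using XY by simp
        then show ?thesis using ij by (simp add: matrix_of_point_def)
      next
        case False then show ?thesis using X Y by (simp add: weight_simplex_def)
      qed
    qed
  qed
  moreover have "?M X \<in> ?I" if X: "X \<in> ?D" for X
  proof -
    have "transpose (?M X) = ?M X"
      by (simp add: transpose_def matrix_of_point_def vec_eq_iff insert_commute)
    moreover have "0 \<le> ?M X $ i $ j" for i j
      using X cls by (auto simp: matrix_of_point_def weight_simplex_def)
    moreover have "(\<Sum>j\<in>UNIV. ?M X $ i $ j) = 1" for i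
      unfolding row using X by (simp add: weight_simplex_def)
    moreover have "?M X $ \<gamma> i $ \<gamma> j = ?M X $ i $ j" if g: "\<gamma> \<in> \<Gamma>" for \<gamma> i j
    proof (cases "{i, j} \<in> E")
      case True
      then have "({i, j}, {\<gamma> i, \<gamma> j}) \<in> ?R"
        using g D(2)[OF g] by (auto simp: edge_equiv_def )
      then show ?thesis
        using True D(2)[OF g] equiv_class_eq[OF eq] by (simp add: matrix_of_point_def)
    next
      case False then show ?thesis using D(2)[OF g] by (simp add: matrix_of_point_def)
    qed
    ultimately show ?thesis
      using noloop by (auto simp: sym_stochastic_def matrix_of_point_def)
  qed
  moreover have "P \<in> ?M ` ?D" if P: "P \<in> ?I" for P
  proof -
    have sym: "P $ i $ j = P $ j $ i" for i j
      using P by (auto simp: sym_stochastic_def transpose_def vec_eq_iff)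
    have inv: "P $ \<gamma> i $ \<gamma> j = P $ i $ j" if "\<gamma> \<in> \<Gamma>" for \<gamma> i j using P that by auto
    define X :: "real^('a set set)" where "X = (\<chi> c. if c \<in> edge_classes \<Gamma> E then
      (let (i, j) = (SOME (i, j). {i, j} \<in> E \<and> c = ?R `` {{i, j}}) in P $ i $ j) else 0)"
    have Xv: "X $ (?R `` {{i, j}}) = P $ i $ j" if ij: "{i, j} \<in> E" for i j
    proof -
      let ?Q = "\<lambda>(k, l). {k, l} \<in> E \<and> ?R `` {{i, j}} = ?R `` {{k, l}}"
      obtain k l where kl: "(SOME p. ?Q p) = (k, l)" by (cases "SOME p. ?Q p")
      have "?Q (i, j)" using ij by simp
      then have "?Q (SOME p. ?Q p)" by (rule someI)
      then have "{k, l} \<in> E" "?R `` {{i, j}} = ?R `` {{k, l}}" using kl by auto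
      then have "({i, j}, {k, l}) \<in> ?R" using ij eq by (metis eq_equiv_class)
      then obtain \<gamma> where g: "\<gamma> \<in> \<Gamma>" "{\<gamma> i, \<gamma> j} = {k, l}" by (auto simp: edge_equiv_def)
      then have "P $ k $ l = P $ \<gamma> i $ \<gamma> j" using sym by (auto simp: doubleton_eq_iff)
      then have "P $ k $ l = P $ i $ j" using inv g by simp
      then show ?thesis using cls[OF ij] kl by (simp add: X_def)
    qed
    have MX: "?M X = P"
      unfolding vec_eq_iff
    proof (intro allI)
      fix i j show "?M X $ i $ j = P $ i $ j"
      proof (cases "{i, j} \<in> E")
        case True then show ?thesis using Xv by (simp add: matrix_of_point_def)
      next
        case False
        then have "P $ i $ j = 0" using P by (cases "i = j") (auto simp: sym_stochastic_def)
        with False show ?thesis by (simp add: matrix_of_point_def)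
      qed
    qed
    have row1: "(\<Sum>j\<in>UNIV. P $ i $ j) = 1" and nn: "0 \<le> P $ i $ j" for i j
      using P by (auto simp: sym_stochastic_def)
    have le1: "P $ i $ j \<le> 1" for i j
      using row1[of i] member_le_sum[of j UNIV "\<lambda>j. P $ i $ j"] nn by auto
    have "X \<in> ?D"
      unfolding weight_simplex_def
    proof (intro CollectI conjI ballI allI impI)
      fix c assume "c \<in> edge_classes \<Gamma> E"
      then obtain i j where "{i, j} \<in> E" "c = ?R `` {{i, j}}" using clsE by blast
      then show "X $ c \<in> {0..1}" using Xv nn le1 by simp
    next
      fix c assume "c \<notin> edge_classes \<Gamma> E" then show "X $ c = 0" by (simp add: X_def)
    next
      show "(\<Sum>c\<in>edge_classes \<Gamma> E. real (edge_multiplicity c) * X $ c) = 1"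
        using row[of X undefined] row1 MX by simp
    qed
    then show ?thesis using MX by blast
  qed
  ultimately show ?thesis unfolding bij_betw_def by blast
qed

end

theory Submission
  imports Defs
begin

text \<open>
  For \<open>P \<in> \<Pi>\<^sub>G\<close> the constant vector is fixed, so \<open>\<lambda>\<^sub>1(P)\<close> is the maximum of the form
  \<open>v \<bullet> P v\<close> over unit vectors \<open>v\<close> orthogonal to it. As a maximum of linear functions \<open>\<lambda>\<^sub>1\<close> is
  convex and Lipschitz: averaging over \<open>\<Gamma>\<close> does not increase it, and neither does replacing an
  invariant \<open>P\<close> with diagonal \<open>d < 1\<close> by \<open>(P - d I) / (1 - d)\<close>, because \<open>\<lambda>\<^sub>1 \<le> 1\<close>. Hence the
  minimum over the compact simplex is a global one. In the Cayley case a vanishing coordinate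
  disconnects the graph of nonzero entries by minimality of \<open>S\<close>, so \<open>\<lambda>\<^sub>1 = 1\<close> on the boundary,
  while \<open>\<lambda>\<^sub>1 < 1\<close> in the interior by connectedness of \<open>G\<close>.
\<close>

section \<open>Orthonormal eigenbases and the characteristic polynomial\<close>

text \<open>The Rayleigh quotient attains its maximum on the compact unit sphere of
  \<open>S\<close>. Since \<open>f\<close> preserves \<open>S\<close>, the first-order condition at
  a maximizer inside \<open>S\<close> is the full eigenvector equation. The eigenvector drives the
  spectral theorem below, the bound the variational formula for \<lambda>_1.\<close>

lemma selfadjoint_rayleigh_max:
  fixes f :: "'a::euclidean_space \<Rightarrow> 'a"
  assumes f: "linear f" and adj: "\<And>x y. f x \<bullet> y = x \<bullet> f y"
    and S: "subspace S" "f ` S \<subseteq> S" "S \<noteq> {0}"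
  obtains v where "v \<in> S" "norm v = 1" "f v = (v \<bullet> f v) *\<^sub>R v"
    "\<And>w. w \<in> S \<Longrightarrow> w \<bullet> f w \<le> (v \<bullet> f v) * (w \<bullet> w)"
proof -
  have scale: "f (c *\<^sub>R w) = c *\<^sub>R f w" for c w using f by (simp add: linear_cmul)
  have nz: "(1 / norm w) *\<^sub>R w \<in> sphere 0 1 \<inter> S" if "w \<in> S" "w \<noteq> 0" for w
    using that S(1) by (simp add: subspace_scale)
  obtain w0 where "w0 \<in> S" "w0 \<noteq> 0" using S(1,3) subspace_0 by blast
  then have "sphere 0 1 \<inter> S \<noteq> {}" using nz by blast
  moreover have "compact (sphere 0 1 \<inter> S)"
    using S(1) by (intro compact_Int_closed compact_sphere closed_subspace)
  moreover have "continuous_on (sphere 0 1 \<inter> S) (\<lambda>v. v \<bullet> f v)"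
    by (intro continuous_intros linear_continuous_on linear_conv_bounded_linear[THEN iffD1, OF f])
  ultimately have "\<exists>v\<in>sphere 0 1 \<inter> S. \<forall>w\<in>sphere 0 1 \<inter> S. w \<bullet> f w \<le> v \<bullet> f v"
    by (intro continuous_attains_sup)
  then obtain v where v: "v \<in> sphere 0 1 \<inter> S"
    and max: "\<And>w. w \<in> sphere 0 1 \<inter> S \<Longrightarrow> w \<bullet> f w \<le> v \<bullet> f v"
    by blast
  define m where "m = v \<bullet> f v"
  have bound: "w \<bullet> f w \<le> m * (w \<bullet> w)" if "w \<in> S" for w
  proof (cases "w = 0")
    case True then show ?thesis using scale[of 0] by simp
  next
    case False
    from max[OF nz[OF that False]] have "(1 / norm w)\<^sup>2 * (w \<bullet> f w) \<le> m"
      by (simp add: scale m_def power2_eq_square)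
    then show ?thesis
      using False by (simp add: field_simps power2_norm_eq_inner)
  qed
  define g where "g w = m *\<^sub>R w - f w" for w
  have g_adj: "g x \<bullet> y = x \<bullet> g y" for x y
    by (simp add: g_def inner_diff adj)
  have vv: "v \<bullet> v = 1" using v by (simp add: norm_eq_1)
  have gS: "g v \<in> S" unfolding g_def using v S by (intro subspace_diff subspace_scale) auto
  define a c where "a = g v \<bullet> g v" and "c = g v \<bullet> g (g v)"
  have c0: "c \<ge> 0"
    using bound[OF gS] by (simp add: c_def g_def[of "g v"] inner_diff_right)
  \<comment> \<open>The form \<open>w \<mapsto> w \<bullet> g w\<close> is nonnegative on \<open>S\<close> and vanishes at \<open>v\<close>, so its gradient \<open>2 g v\<close> vanishes.\<close>
  have quad: "0 \<le> 2 * t * a + t\<^sup>2 * c" for t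
  proof -
    let ?w = "v + t *\<^sub>R g v"
    have "?w \<in> S" using v gS S(1) by (simp add: subspace_add subspace_scale)
    from bound[OF this] have "0 \<le> ?w \<bullet> g ?w"
      by (simp add: g_def[of ?w] inner_diff_right)
    also have "g ?w = g v + t *\<^sub>R g (g v)"
      by (simp add: g_def scale linear_add[OF f] linear_diff[OF f] algebra_simps)
    also have "?w \<bullet> (g v + t *\<^sub>R g (g v)) = v \<bullet> g v + t * a + t * (v \<bullet> g (g v)) + t\<^sup>2 * c"
      by (simp add: a_def c_def inner_add power2_eq_square algebra_simps)
    also have "v \<bullet> g v = 0" by (simp add: g_def inner_diff_right vv m_def)
    also have "v \<bullet> g (g v) = a"
      unfolding a_def by (rule g_adj[symmetric])
    finally show ?thesis by (simp add: mult_ac)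
  qed
  have "a = 0"
  proof (rule ccontr)
    assume "a \<noteq> 0"
    then have a: "a > 0" by (simp add: a_def)
    \<comment> \<open>The quadratic in \<open>t\<close> is minimal at \<open>- a / c\<close>; the
      \<open>+ 1\<close> in the denominator keeps the value negative and also covers
      \<open>c = 0\<close>.\<close>
    have "0 \<le> 2 * (- a / (c + 1)) * a + (- a / (c + 1))\<^sup>2 * c" by (rule quad)
    also have "\<dots> = - (a\<^sup>2 * (c + 2)) / (c + 1)\<^sup>2"
      using c0 by (simp add: divide_simps) (simp add: algebra_simps power2_eq_square)
    also have "\<dots> < 0" using a c0 by (intro divide_neg_pos) auto
    finally show False by simp
  qed
  then have "f v = m *\<^sub>R v" by (simp add: a_def g_def)
  then show thesis using that[of v] v bound by (auto simp: m_def)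
qed

text \<open>Induction on the dimension: split off a Rayleigh maximizer \<open>v\<close>. Its
  orthogonal complement in \<open>S\<close> is again invariant, because \<open>f\<close> is
  self-adjoint and \<open>v\<close> is an eigenvector. Eigenvalues appear as
  \<open>b \<bullet> f b\<close>, so no separate eigenvalue function is carried along.\<close>

lemma selfadjoint_orthonormal_eigenbasis:
  fixes f :: "'a::euclidean_space \<Rightarrow> 'a"
  assumes f: "linear f" and adj: "\<And>x y. f x \<bullet> y = x \<bullet> f y"
  assumes "subspace S" "f ` S \<subseteq> S"
  shows "\<exists>B. B \<subseteq> S \<and> S \<subseteq> span B \<and> pairwise orthogonal B \<and>
    (\<forall>b\<in>B. norm b = 1 \<and> f b = (b \<bullet> f b) *\<^sub>R b)"
  using assms(3,4)
proof (induction "dim S" arbitrary: S rule: less_induct)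
  case less
  show ?case
  proof (cases "S = {0}")
    case True
    then show ?thesis by (intro exI[of _ "{}"]) auto
  next
    case False
    obtain v where v: "v \<in> S" "norm v = 1" "f v = (v \<bullet> f v) *\<^sub>R v"
      using selfadjoint_rayleigh_max[OF f adj less.prems False] by blast
    define T where "T = {y \<in> S. v \<bullet> y = 0}"
    have T: "subspace T"
      using less.prems(1) unfolding T_def subspace_def by (auto simp: inner_add_right)
    have "v \<notin> T" using v(2) by (auto simp: T_def norm_eq_1)
    moreover have "T \<subseteq> S" by (auto simp: T_def)
    ultimately have "T \<subset> S" using v(1) by blast
    then have "dim T < dim S"
      using T less.prems(1) by (intro dim_psubset) (simp add: span_eq_iff[THEN iffD2])
    moreover have "f ` T \<subseteq> T"
    proof clarify
      fix y assume y: "y \<in> T"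
      have "v \<bullet> f y = f v \<bullet> y" using adj[of v y] by simp
      also have "\<dots> = (v \<bullet> f v) * (v \<bullet> y)" by (subst v(3)) simp
      finally show "f y \<in> T" using y less.prems(2) by (auto simp: T_def)
    qed
    ultimately obtain B where B: "B \<subseteq> T" "T \<subseteq> span B" "pairwise orthogonal B"
      "\<forall>b\<in>B. norm b = 1 \<and> f b = (b \<bullet> f b) *\<^sub>R b"
      using less.hyps[OF _ T] by blast
    have "y \<in> span (insert v B)" if "y \<in> S" for y
    proof -
      have "y - (v \<bullet> y) *\<^sub>R v \<in> T"
        using that v less.prems(1)
        by (simp add: T_def subspace_diff subspace_scale inner_diff_right norm_eq_1)
      then show ?thesis using B(2) by (auto simp: span_insert)
    qed
    moreover have "pairwise orthogonal (insert v B)"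
      using B(1,3) by (auto simp: pairwise_insert orthogonal_def T_def inner_commute)
    ultimately show ?thesis
      using B v \<open>T \<subset> S\<close> by (intro exI[of _ "insert v B"]) auto
  qed
qed

text \<open>With the eigenvectors as rows of \<open>Q\<close>, the identity Q (x I - P) = D Q holds
  over the polynomial ring, where \<open>D\<close> is diagonal with entries x - d_i. Taking
  determinants and cancelling that of \<open>Q\<close> gives the factorization.\<close>

lemma charpoly_orthonormal_eigenbasis:
  fixes P :: "real^'v^'v" and b :: "'v::finite \<Rightarrow> real^'v"
  assumes P: "transpose P = P"
    and b: "\<And>i j. b i \<bullet> b j = (if i = j then 1 else 0)" "\<And>i. P *v b i = d i *\<^sub>R b i"
  shows "charpoly P = (\<Prod>i\<in>UNIV. [:- d i, 1:])"
proof -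
  define C :: "real^'v^'v \<Rightarrow> real poly^'v^'v" where "C = map_matrix (\<lambda>a. [:a:])"
  have const_sum: "(\<Sum>k\<in>A. [:h k:]) = [:\<Sum>k\<in>A. h k:]" for h :: "'v \<Rightarrow> real" and A
    by (induction A rule: infinite_finite_induct) auto
  have C_mult: "C A ** C B = C (A ** B)" for A B
    by (simp add: C_def matrix_matrix_mult_def vec_eq_iff const_sum mult.commute)
  define Q :: "real^'v^'v" where "Q = (\<chi> i j. b i $ j)"
  define D :: "real poly^'v^'v" where "D = (\<chi> i j. if i = j then [:- d i, 1:] else 0)"
  have "Q ** transpose Q = mat 1"
    using b(1) by (simp add: Q_def matrix_matrix_mult_def transpose_def mat_def vec_eq_iff inner_vec_def)
  then have "C Q ** C (transpose Q) = C (mat 1)" by (simp add: C_mult)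
  also have "C (mat 1) = mat 1" by (simp add: C_def mat_def vec_eq_iff)
  finally have "det (C Q) * det (C (transpose Q)) = 1" by (metis det_mul det_I)
  then have Q0: "det (C Q) \<noteq> 0" by auto
  \<comment> \<open>Symmetry of \<open>P\<close> turns its column eigenvectors into row
    eigenvectors, so row \<open>i\<close> of \<open>Q ** P\<close> is \<open>d i\<close> times row
    \<open>i\<close> of \<open>Q\<close>.\<close>
  have "C Q ** (mat [:0, 1:] - C P) = D ** C Q"
    unfolding vec_eq_iff
  proof (intro allI)
    fix i j
    have Psym: "P $ k $ j = P $ j $ k" for k
      using P by (simp add: transpose_def vec_eq_iff)
    have "(\<Sum>k\<in>UNIV. b i $ k * P $ k $ j) = d i * b i $ j"
      using arg_cong[OF b(2)[of i], of "\<lambda>x. x $ j"]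
      by (simp add: matrix_vector_mult_def Psym mult.commute)
    then have "(C Q ** C P) $ i $ j = [:d i * b i $ j:]"
      by (simp add: C_mult) (simp add: C_def Q_def matrix_matrix_mult_def)
    moreover have "(C Q ** mat [:0, 1:]) $ i $ j = C Q $ i $ j * [:0, 1:]"
      by (simp add: matrix_matrix_mult_def mat_def if_distrib cong: if_cong)
    moreover have "(D ** C Q) $ i $ j = [:- d i, 1:] * C Q $ i $ j"
      by (simp add: matrix_matrix_mult_def D_def if_distrib[of "\<lambda>x. x * _"] cong: if_cong)
    moreover have "(C Q ** (mat [:0, 1:] - C P)) $ i $ j = (C Q ** mat [:0, 1:]) $ i $ j - (C Q ** C P) $ i $ j"
      by (simp add: matrix_matrix_mult_def right_diff_distrib sum_subtractf)
    ultimately show "(C Q ** (mat [:0, 1:] - C P)) $ i $ j = (D ** C Q) $ i $ j"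
      by (simp add: C_def Q_def)
  qed
  then have "det (C Q) * charpoly P = det D * det (C Q)"
    unfolding charpoly_def C_def[symmetric] by (metis det_mul)
  then have "charpoly P = det D" using Q0 by simp
  also have "det D = (\<Prod>i\<in>UNIV. [:- d i, 1:])"
    by (subst det_diagonal) (auto simp: D_def)
  finally show ?thesis .
qed

text \<open>The largest root \<open>a\<close> occupies index 0, so index 1 holds the maximum of what
  remains; this includes the case \<open>m = a\<close> of a repeated root. Below, \<open>a\<close>
  is the eigenvalue 1 of the constant vector.\<close>

lemma rev_sorted_list_of_multiset_add_max_nth_1:
  assumes "\<And>x. x \<in># N \<Longrightarrow> x \<le> a" and "m \<in># N" "\<And>x. x \<in># N \<Longrightarrow> x \<le> m"
  shows "rev (sorted_list_of_multiset (add_mset a N)) ! 1 = m"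
proof -
  obtain M where N: "N = add_mset m M" using assms(2) by (metis multi_member_split)
  have "sorted_list_of_multiset N = sorted_list_of_multiset M @ [m]"
    unfolding N using assms(3) N by (simp add: insort_is_Cons sorted_insort_is_snoc)
  moreover have "sorted_list_of_multiset (add_mset a N) = sorted_list_of_multiset N @ [a]"
    using assms(1) by (simp add: sorted_insort_is_snoc)
  ultimately show ?thesis by simp
qed

section \<open>The second eigenvalue of a symmetric stochastic matrix\<close>

lemma sym_stochasticD:
  assumes "P \<in> sym_stochastic E"
  shows "transpose P = P" "P $ i $ j = P $ j $ i" "0 \<le> P $ i $ j" "(\<Sum>j\<in>UNIV. P $ i $ j) = 1"
    "i \<noteq> j \<Longrightarrow> {i, j} \<notin> E \<Longrightarrow> P $ i $ j = 0"
  using assms by (auto simp: sym_stochastic_def transpose_def vec_eq_iff)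

section \<open>Quadratic forms of symmetric stochastic matrices\<close>

lemma inner_matrix_vector_mult_self:
  fixes P :: "real^'v^'v"
  shows "x \<bullet> (P *v x) = (\<Sum>i\<in>UNIV. \<Sum>j\<in>UNIV. P $ i $ j * (x $ i * x $ j))"
  by (simp add: inner_vec_def matrix_vector_mult_def sum_distrib_left mult_ac)

lemma sym_stochastic_sum_weighted_squares:
  assumes P: "P \<in> sym_stochastic E"
  shows "(\<Sum>i\<in>UNIV. \<Sum>j\<in>UNIV. P $ i $ j * (x $ i)\<^sup>2) = x \<bullet> x"
    and "(\<Sum>i\<in>UNIV. \<Sum>j\<in>UNIV. P $ i $ j * (x $ j)\<^sup>2) = x \<bullet> x"
proof -
  show 1: "(\<Sum>i\<in>UNIV. \<Sum>j\<in>UNIV. P $ i $ j * (x $ i)\<^sup>2) = x \<bullet> x"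
    by (simp add: sum_distrib_right[symmetric] sym_stochasticD(4)[OF P] inner_vec_def power2_eq_square)
  show "(\<Sum>i\<in>UNIV. \<Sum>j\<in>UNIV. P $ i $ j * (x $ j)\<^sup>2) = x \<bullet> x"
    unfolding 1[symmetric] by (subst sum.swap) (simp add: sym_stochasticD(2)[OF P])
qed

text \<open>This is the form of the weighted graph Laplacian I - P. It bounds the eigenvalues by 1,
  and its vanishing means that \<open>x\<close> agrees on any two vertices joined by a nonzero
  entry; both the interior and the boundary case rest on that.\<close>

lemma sym_stochastic_dirichlet_form:
  assumes P: "P \<in> sym_stochastic E"
  shows "(\<Sum>i\<in>UNIV. \<Sum>j\<in>UNIV. P $ i $ j * (x $ i - x $ j)\<^sup>2) = 2 * (x \<bullet> x - x \<bullet> (P *v x))"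
proof -
  have "(\<Sum>i\<in>UNIV. \<Sum>j\<in>UNIV. P $ i $ j * (x $ i - x $ j)\<^sup>2) =
    (\<Sum>i\<in>UNIV. \<Sum>j\<in>UNIV. P $ i $ j * (x $ i)\<^sup>2 + P $ i $ j * (x $ j)\<^sup>2 - 2 * (P $ i $ j * (x $ i * x $ j)))"
    by (intro sum.cong refl) (simp add: power2_eq_square algebra_simps)
  then show ?thesis
    by (simp add: sum.distrib sum_subtractf sym_stochastic_sum_weighted_squares[OF P]
        inner_matrix_vector_mult_self sum_distrib_left)
qed

text \<open>The counterpart for I + P, from which the lower bound -1 follows.\<close>

lemma sym_stochastic_signless_form:
  assumes P: "P \<in> sym_stochastic E"
  shows "(\<Sum>i\<in>UNIV. \<Sum>j\<in>UNIV. P $ i $ j * (x $ i + x $ j)\<^sup>2) = 2 * (x \<bullet> x + x \<bullet> (P *v x))"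
proof -
  have "(\<Sum>i\<in>UNIV. \<Sum>j\<in>UNIV. P $ i $ j * (x $ i + x $ j)\<^sup>2) =
    (\<Sum>i\<in>UNIV. \<Sum>j\<in>UNIV. P $ i $ j * (x $ i)\<^sup>2 + P $ i $ j * (x $ j)\<^sup>2 + 2 * (P $ i $ j * (x $ i * x $ j)))"
    by (intro sum.cong refl) (simp add: power2_eq_square algebra_simps)
  then show ?thesis
    by (simp add: sum.distrib sym_stochastic_sum_weighted_squares[OF P]
        inner_matrix_vector_mult_self sum_distrib_left)
qed

lemma sym_stochastic_quadratic_form_bounds:
  assumes P: "P \<in> sym_stochastic E"
  shows "x \<bullet> (P *v x) \<le> x \<bullet> x" "- (x \<bullet> x) \<le> x \<bullet> (P *v x)"
proof -
  have "0 \<le> (\<Sum>i\<in>UNIV. \<Sum>j\<in>UNIV. P $ i $ j * (x $ i - x $ j)\<^sup>2)"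
    by (intro sum_nonneg mult_nonneg_nonneg sym_stochasticD(3)[OF P]) simp
  then show "x \<bullet> (P *v x) \<le> x \<bullet> x" by (simp add: sym_stochastic_dirichlet_form[OF P])
  have "0 \<le> (\<Sum>i\<in>UNIV. \<Sum>j\<in>UNIV. P $ i $ j * (x $ i + x $ j)\<^sup>2)"
    by (intro sum_nonneg mult_nonneg_nonneg sym_stochasticD(3)[OF P]) simp
  then show "- (x \<bullet> x) \<le> x \<bullet> (P *v x)" by (simp add: sym_stochastic_signless_form[OF P])
qed

text \<open>Courant-Fischer for the second eigenvalue. The constant vector \<open>1\<close> is fixed
  by \<open>P\<close>, so its complement \<open>S\<close> is invariant. The normalized constant
  vector and an eigenbasis of \<open>S\<close> together list all roots with multiplicity, and
  removing one root 1, the largest, leaves the Rayleigh maximum on \<open>S\<close> on top. Later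
  arguments use \<open>eigval 1\<close> only through this characterization.\<close>

lemma eigval_1_variational:
  fixes P :: "real^'v::finite^'v"
  assumes n: "CARD('v) \<ge> 2" and P: "P \<in> sym_stochastic E"
  obtains v where "1 \<bullet> v = 0" "norm v = 1" "P *v v = eigval 1 P *\<^sub>R v"
    and "\<And>w. 1 \<bullet> w = 0 \<Longrightarrow> w \<bullet> (P *v w) \<le> eigval 1 P * (w \<bullet> w)"
proof -
  define f where "f = (\<lambda>x. P *v x)"
  have f: "linear f" by (simp add: f_def)
  have adj: "f x \<bullet> y = x \<bullet> f y" for x y
    by (simp add: f_def dot_lmul_matrix[symmetric] flip: vector_transpose_matrix)
       (metis sym_stochasticD(1)[OF P] dot_lmul_matrix vector_transpose_matrix)
  have f1: "f 1 = 1"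
    using sym_stochasticD(4)[OF P] by (simp add: f_def matrix_vector_mult_def vec_eq_iff)
  define S where "S = {x :: real^'v. 1 \<bullet> x = 0}"
  have S: "subspace S" unfolding S_def by (rule subspace_hyperplane)
  have fS: "f ` S \<subseteq> S"
    using adj[of 1] f1 by (auto simp: S_def)
  have one: "(1 :: real^'v) \<bullet> 1 = CARD('v)" by (simp add: inner_vec_def)
  have one0: "(1 :: real^'v) \<noteq> 0" using one n by auto
  have dimS: "dim S = CARD('v) - 1"
    using dim_hyperplane[OF one0] by (simp add: S_def)
  then have S0: "S \<noteq> {0}" using n by auto
  obtain v where v: "v \<in> S" "norm v = 1" "f v = (v \<bullet> f v) *\<^sub>R v"
    "\<And>w. w \<in> S \<Longrightarrow> w \<bullet> f w \<le> (v \<bullet> f v) * (w \<bullet> w)"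
    using selfadjoint_rayleigh_max[OF f adj S fS S0] by blast
  define m where "m = v \<bullet> f v"
  obtain B where B: "B \<subseteq> S" "S \<subseteq> span B" "pairwise orthogonal B"
      "\<forall>b\<in>B. norm b = 1 \<and> f b = (b \<bullet> f b) *\<^sub>R b"
    using selfadjoint_orthonormal_eigenbasis[OF f adj S fS] by blast
  have indB: "independent B"
    using B by (intro pairwise_orthogonal_independent) auto
  have finB: "finite B" using indB by (rule finiteI_independent)
  have cardB: "card B = CARD('v) - 1"
    using basis_card_eq_dim[OF B(1,2) indB] dimS by simp
  define u where "u = (1 / sqrt (CARD('v))) *\<^sub>R (1 :: real^'v)"
  have u: "u \<bullet> u = 1" "f u = u"
    using n f1 f by (simp_all add: u_def one linear_cmul)
  have ub: "u \<bullet> b = 0" if "b \<in> B" for b using that B(1) by (auto simp: u_def S_def)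
  then have bu: "b \<bullet> u = 0" if "b \<in> B" for b using that by (simp add: inner_commute)
  have uB: "u \<notin> B" using ub u(1) by force
  have "card (insert u B) = CARD('v)" using uB finB cardB n by simp
  \<comment> \<open>The factorization of \<open>charpoly\<close> expects the basis to be indexed by
    the vertices.\<close>
  then obtain b where b: "bij_betw b (UNIV :: 'v set) (insert u B)"
    using finB finite_same_card_bij[of "UNIV :: 'v set" "insert u B"] by auto
  define d where "d x = x \<bullet> f x" for x
  have "charpoly P = (\<Prod>i\<in>UNIV. [:- d (b i), 1:])"
  proof (rule charpoly_orthonormal_eigenbasis[OF sym_stochasticD(1)[OF P]])
    have bB: "b i \<in> insert u B" for i using b by (auto simp: bij_betw_def)
    have inj: "b i = b j \<longleftrightarrow> i = j" for i j using b by (auto simp: bij_betw_def inj_on_def)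
    show "b i \<bullet> b j = (if i = j then 1 else 0)" for i j
    proof (cases "i = j")
      case True then show ?thesis using bB[of i] u(1) B(4) by (auto simp: norm_eq_1)
    next
      case False
      then have "b i \<noteq> b j" using inj by simp
      then show ?thesis
        using False bB[of i] bB[of j] B(3) ub bu
        by (auto simp: pairwise_def orthogonal_def)
    qed
    show "P *v b i = d (b i) *\<^sub>R b i" for i
      using bB[of i] u B(4) by (auto simp: d_def f_def)
  qed
  then have "proots (charpoly P) = (\<Sum>i\<in>UNIV. {#d (b i)#})"
    by (simp add: proots_prod)
  also have "\<dots> = (\<Sum>x\<in>insert u B. {#d x#})"
    using sum.reindex_bij_betw[OF b] by simp
  also have "\<dots> = add_mset 1 (\<Sum>x\<in>B. {#d x#})"
    using uB finB u by (simp add: d_def)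
  finally have roots: "proots (charpoly P) = add_mset 1 (\<Sum>x\<in>B. {#d x#})" .
  have set_roots: "set_mset (\<Sum>x\<in>B. {#d x#}) = d ` B"
    using finB by (simp add: set_mset_sum) blast
  \<comment> \<open>The maximizer \<open>v\<close> need not belong to \<open>B\<close>. It is not
    orthogonal to all of \<open>B\<close>, and eigenvectors of a self-adjoint map with nonzero inner
    product share their eigenvalue, so \<open>m\<close> does occur among the roots
    \<open>d b\<close>.\<close>
  have "\<exists>b\<in>B. v \<bullet> b \<noteq> 0"
  proof (rule ccontr)
    assume "\<not> (\<exists>b\<in>B. v \<bullet> b \<noteq> 0)"
    then have "orthogonal v b" if "b \<in> B" for b using that by (simp add: orthogonal_def)
    then have "orthogonal v v" using B(2) v(1) by (meson orthogonal_to_span subsetD)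
    then show False using v(2) by (simp add: orthogonal_self)
  qed
  then obtain b0 where b0: "b0 \<in> B" "v \<bullet> b0 \<noteq> 0" by blast
  have "m * (v \<bullet> b0) = f v \<bullet> b0" by (subst v(3)) (simp add: m_def)
  also have "\<dots> = d b0 * (v \<bullet> b0)"
    using B(4) b0(1) by (subst adj) (metis d_def inner_scaleR_right)
  finally have "m = d b0" using b0(2) by simp
  have "eigval 1 P = m"
    unfolding eigval_def roots
  proof (rule rev_sorted_list_of_multiset_add_max_nth_1)
    show "m \<in># (\<Sum>x\<in>B. {#d x#})" using \<open>m = d b0\<close> b0(1) by (simp add: set_roots)
    fix x assume "x \<in># (\<Sum>x\<in>B. {#d x#})"
    then obtain b where b: "b \<in> B" "x = d b" by (auto simp: set_roots)
    then have "b \<bullet> b = 1" using B(4) by (simp add: norm_eq_1)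
    then show "x \<le> 1" "x \<le> m"
      using sym_stochastic_quadratic_form_bounds(1)[OF P, of b] v(4)[of b] b B(1)
      by (auto simp: d_def f_def m_def)
  qed
  then show thesis
    using that[of v] v by (simp add: S_def m_def f_def)
qed

lemma eigval_1_le:
  fixes P :: "real^'v::finite^'v"
  assumes "CARD('v) \<ge> 2" "P \<in> sym_stochastic E" "1 \<bullet> w = 0"
  shows "w \<bullet> (P *v w) \<le> eigval 1 P * (w \<bullet> w)"
  using eigval_1_variational[OF assms(1,2)] assms(3) by metis

lemma eigval_1_range:
  fixes P :: "real^'v::finite^'v"
  assumes "CARD('v) \<ge> 2" "P \<in> sym_stochastic E"
  shows "eigval 1 P \<in> {-1..1}"
proof -
  obtain v where v: "norm v = 1" "P *v v = eigval 1 P *\<^sub>R v"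
    using eigval_1_variational[OF assms] by blast
  then have "v \<bullet> v = 1" by (simp add: norm_eq_1)
  then show ?thesis
    using sym_stochastic_quadratic_form_bounds[OF assms(2), of v] v by simp
qed

text \<open>Test the form of \<open>Q\<close> on a unit vector that is maximal for \<open>P\<close>:
  its entries have absolute value at most 1, so the two forms differ there by at most the sum of the
  entrywise differences. Exchanging \<open>P\<close> and \<open>Q\<close> gives the absolute
  value.\<close>

lemma eigval_1_lipschitz:
  fixes P Q :: "real^'v::finite^'v"
  assumes n: "CARD('v) \<ge> 2" and P: "P \<in> sym_stochastic E" and Q: "Q \<in> sym_stochastic E"
  shows "\<bar>eigval 1 P - eigval 1 Q\<bar> \<le> (\<Sum>i\<in>UNIV. \<Sum>j\<in>UNIV. \<bar>P $ i $ j - Q $ i $ j\<bar>)"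
proof -
  have *: "eigval 1 P - eigval 1 Q \<le> (\<Sum>i\<in>UNIV. \<Sum>j\<in>UNIV. \<bar>P $ i $ j - Q $ i $ j\<bar>)"
    if P: "P \<in> sym_stochastic E" and Q: "Q \<in> sym_stochastic E" for P Q :: "real^'v^'v"
  proof -
    obtain v where v: "1 \<bullet> v = 0" "norm v = 1" "P *v v = eigval 1 P *\<^sub>R v"
      using eigval_1_variational[OF n P] by blast
    have vv: "v \<bullet> v = 1" using v(2) by (simp add: norm_eq_1)
    have "eigval 1 P - eigval 1 Q \<le> v \<bullet> (P *v v) - v \<bullet> (Q *v v)"
      using eigval_1_le[OF n Q v(1)] v(3) vv by simp
    also have "\<dots> = (\<Sum>i\<in>UNIV. \<Sum>j\<in>UNIV. (P $ i $ j - Q $ i $ j) * (v $ i * v $ j))"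
      by (simp add: inner_matrix_vector_mult_self sum_subtractf left_diff_distrib)
    also have "\<dots> \<le> (\<Sum>i\<in>UNIV. \<Sum>j\<in>UNIV. \<bar>P $ i $ j - Q $ i $ j\<bar>)"
    proof (intro sum_mono)
      fix i j
      have "\<bar>v $ i\<bar> \<le> 1" for i using component_le_norm_cart[of v i] v(2) by simp
      then have "\<bar>v $ i * v $ j\<bar> \<le> 1" unfolding abs_mult by (intro mult_le_one) auto
      then have "\<bar>(P $ i $ j - Q $ i $ j) * (v $ i * v $ j)\<bar> \<le> \<bar>P $ i $ j - Q $ i $ j\<bar>"
        by (subst abs_mult) (intro mult_left_le; simp)
      then show "(P $ i $ j - Q $ i $ j) * (v $ i * v $ j) \<le> \<bar>P $ i $ j - Q $ i $ j\<bar>" by simp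
    qed
    finally show ?thesis .
  qed
  show ?thesis
    using *[OF P Q] *[OF Q P] by (simp add: abs_minus_commute abs_le_iff)
qed

section \<open>Minimization over the simplex of invariant matrices\<close>

text \<open>The average of \<open>P\<close> over simultaneous permutations of rows and columns. As
  \<open>\<Gamma>\<close> is a set of functions on a finite type, it is finite, and for a subgroup
  \<open>card \<Gamma>\<close> is positive.\<close>

definition symmetrization :: "('v \<Rightarrow> 'v) set \<Rightarrow> real^'v^'v \<Rightarrow> real^'v^'v" where
  "symmetrization \<Gamma> P = (\<chi> i j. (\<Sum>\<gamma>\<in>\<Gamma>. P $ \<gamma> i $ \<gamma> j) / real (card \<Gamma>))"

lemma symmetrization_sym_stochastic:
  assumes \<Gamma>: "subgroup \<Gamma> (graph_aut_group E)" and P: "P \<in> sym_stochastic E"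
  shows "symmetrization \<Gamma> P \<in> sym_stochastic E"
proof -
  note D = graph_aut_subgroupD[OF \<Gamma>]
  have ne: "\<Gamma> \<noteq> {}" using D(3) by blast
  have row: "(\<Sum>j\<in>UNIV. P $ \<gamma> i $ \<gamma> j) = 1" if "\<gamma> \<in> \<Gamma>" for \<gamma> i
    using sum.reindex_bij_betw[OF D(1)[OF that], of "\<lambda>j. P $ \<gamma> i $ j"] sym_stochasticD(4)[OF P]
    by simp
  have "(\<Sum>j\<in>UNIV. symmetrization \<Gamma> P $ i $ j) = 1" for i
  proof -
    have "(\<Sum>j\<in>UNIV. symmetrization \<Gamma> P $ i $ j) = (\<Sum>j\<in>UNIV. \<Sum>\<gamma>\<in>\<Gamma>. P $ \<gamma> i $ \<gamma> j) / real (card \<Gamma>)"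
      by (simp add: symmetrization_def sum_divide_distrib)
    also have "\<dots> = (\<Sum>\<gamma>\<in>\<Gamma>. \<Sum>j\<in>UNIV. P $ \<gamma> i $ \<gamma> j) / real (card \<Gamma>)"
      by (subst sum.swap) simp
    finally show ?thesis using ne by (simp add: row)
  qed
  moreover have "transpose (symmetrization \<Gamma> P) = symmetrization \<Gamma> P"
    using sym_stochasticD(2)[OF P] by (simp add: symmetrization_def transpose_def vec_eq_iff)
  moreover have "0 \<le> symmetrization \<Gamma> P $ i $ j" for i j
    using sym_stochasticD(3)[OF P] by (simp add: symmetrization_def sum_nonneg)
  moreover have "symmetrization \<Gamma> P $ i $ j = 0" if "i \<noteq> j" "{i, j} \<notin> E" for i j
  proof -
    have "P $ \<gamma> i $ \<gamma> j = 0" if "\<gamma> \<in> \<Gamma>" for \<gamma>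
      using sym_stochasticD(5)[OF P, of "\<gamma> i" "\<gamma> j"] D(1,2)[OF that] \<open>i \<noteq> j\<close> \<open>{i, j} \<notin> E\<close>
      by (simp add: bij_is_inj inj_eq)
    then show ?thesis by (simp add: symmetrization_def)
  qed
  ultimately show ?thesis by (simp add: sym_stochastic_def)
qed

lemma symmetrization_invariant:
  assumes \<Gamma>: "subgroup \<Gamma> (graph_aut_group E)" and \<delta>: "\<delta> \<in> \<Gamma>"
  shows "symmetrization \<Gamma> P $ \<delta> i $ \<delta> j = symmetrization \<Gamma> P $ i $ j"
proof -
  note D = graph_aut_subgroupD[OF \<Gamma>]
  obtain \<epsilon> where \<epsilon>: "\<epsilon> \<in> \<Gamma>" "\<epsilon> \<circ> \<delta> = id" "\<delta> \<circ> \<epsilon> = id" using D(5)[OF \<delta>] by blast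
  have "(\<Sum>\<gamma>\<in>\<Gamma>. P $ \<gamma> (\<delta> i) $ \<gamma> (\<delta> j)) = (\<Sum>\<gamma>\<in>\<Gamma>. P $ \<gamma> i $ \<gamma> j)"
    using D(4) \<delta> \<epsilon>
    by (intro sum.reindex_bij_witness[of _ "\<lambda>\<gamma>. \<gamma> \<circ> \<epsilon>" "\<lambda>\<gamma>. \<gamma> \<circ> \<delta>"]) (simp_all add: comp_assoc)
  then show ?thesis by (simp add: symmetrization_def)
qed

text \<open>Convexity together with invariance under relabelling: the form of each permuted copy of
  \<open>P\<close> at \<open>v\<close> is the form of \<open>P\<close> at a permuted vector, which
  is still a unit vector orthogonal to the constants. Each summand is therefore at most
  \<open>eigval 1 P\<close>, and so is the average.\<close>

lemma eigval_1_symmetrization_le: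
  fixes P :: "real^'v::finite^'v"
  assumes n: "CARD('v) \<ge> 2" and \<Gamma>: "subgroup \<Gamma> (graph_aut_group E)" and P: "P \<in> sym_stochastic E"
  shows "eigval 1 (symmetrization \<Gamma> P) \<le> eigval 1 P"
proof -
  note D = graph_aut_subgroupD[OF \<Gamma>]
  have ne: "\<Gamma> \<noteq> {}" using D(3) by blast
  let ?Q = "symmetrization \<Gamma> P"
  obtain v where v: "1 \<bullet> v = 0" "norm v = 1" "?Q *v v = eigval 1 ?Q *\<^sub>R v"
    using eigval_1_variational[OF n symmetrization_sym_stochastic[OF \<Gamma> P]] by blast
  have vv: "v \<bullet> v = 1" using v(2) by (simp add: norm_eq_1)
  have summand: "(\<Sum>i\<in>UNIV. \<Sum>j\<in>UNIV. P $ \<gamma> i $ \<gamma> j * (v $ i * v $ j)) \<le> eigval 1 P" if "\<gamma> \<in> \<Gamma>" for \<gamma>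
  proof -
    have bij: "bij \<gamma>" using D(1) that .
    note reindex = sum.reindex_bij_betw[OF bij]
    \<comment> \<open>\<open>w\<close> is \<open>v\<close> transported along
      \<open>\<gamma>\<close>; reindexing by \<open>\<gamma>\<close> in each sum brings back
      \<open>v\<close>.\<close>
    define w :: "real^'v" where "w = (\<chi> k. v $ (Hilbert_Choice.inv \<gamma> k))"
    have w: "w $ \<gamma> i = v $ i" for i using bij by (simp add: w_def bij_is_inj)
    have "1 \<bullet> w = 0"
      using v(1) reindex[of "\<lambda>k. w $ k"] by (simp add: inner_vec_def w)
    moreover have "w \<bullet> w = 1"
      using vv reindex[of "\<lambda>k. w $ k * w $ k"] by (simp add: inner_vec_def w)
    moreover have "w \<bullet> (P *v w) = (\<Sum>i\<in>UNIV. \<Sum>j\<in>UNIV. P $ \<gamma> i $ \<gamma> j * (v $ i * v $ j))"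
      unfolding inner_matrix_vector_mult_self w[symmetric]
      by (simp add: reindex[of "\<lambda>l. P $ _ $ l * (w $ _ * w $ l)"]
          reindex[of "\<lambda>k. \<Sum>l\<in>UNIV. P $ k $ l * (w $ k * w $ l)"])
    ultimately show ?thesis using eigval_1_le[OF n P, of w] by simp
  qed
  have "eigval 1 ?Q = v \<bullet> (?Q *v v)" using v(3) vv by simp
  also have "\<dots> = (\<Sum>i\<in>UNIV. \<Sum>j\<in>UNIV. \<Sum>\<gamma>\<in>\<Gamma>. P $ \<gamma> i $ \<gamma> j * (v $ i * v $ j)) / real (card \<Gamma>)"
    unfolding inner_matrix_vector_mult_self
    by (simp add: symmetrization_def sum_divide_distrib sum_distrib_right)
  also have "\<dots> = (\<Sum>\<gamma>\<in>\<Gamma>. \<Sum>i\<in>UNIV. \<Sum>j\<in>UNIV. P $ \<gamma> i $ \<gamma> j * (v $ i * v $ j)) / real (card \<Gamma>)"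
    by (simp only: sum.swap[of _ \<Gamma> UNIV])
  also have "\<dots> \<le> (real (card \<Gamma>) * eigval 1 P) / real (card \<Gamma>)"
    using sum_bounded_above[OF summand] by (intro divide_right_mono) auto
  also have "\<dots> = eigval 1 P" using ne by simp
  finally show ?thesis .
qed

section \<open>Points of the simplex and how they dominate arbitrary matrices\<close>

lemma weight_simplex_matrix:
  assumes "simple_graph E" "subgroup \<Gamma> (graph_aut_group E)" "vertex_transitive \<Gamma>"
    and "X \<in> weight_simplex \<Gamma> E"
  shows "matrix_of_point \<Gamma> E X \<in> sym_stochastic E"
  using bij_betwE[OF weight_simplex_bij_invariant_matrices[OF assms(1-3)]] assms(4) by auto

lemma edge_multiplicity_pos:
  assumes "simple_graph E" "subgroup \<Gamma> (graph_aut_group E)" "vertex_transitive \<Gamma>"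
    and c: "c \<in> edge_classes \<Gamma> E"
  shows "0 < edge_multiplicity c"
proof -
  obtain e where e: "e \<in> E" "e \<in> c"
    using c equiv_class_self[OF equiv_edge_equiv[OF assms(2)]]
    by (auto simp: edge_classes_def elim!: quotientE)
  then obtain i where "i \<in> e" using simple_graph_edgeE[OF assms(1)] by blast
  then have "{e \<in> c. i \<in> e} \<noteq> {}" using e by blast
  then show ?thesis
    using edge_multiplicity_eq[OF assms, of i] by (metis card_gt_0_iff finite)
qed

lemma connected_graph_nonempty:
  fixes E :: "'v::finite set set"
  assumes "CARD('v) \<ge> 2" "connected_graph E"
  shows "E \<noteq> {}"
proof -
  obtain i j :: 'v where "i \<noteq> j"
    using assms(1) by (metis One_nat_def Suc_1 card_le_Suc0_iff_eq finite not_less_eq_eq UNIV_I)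
  moreover have "(i, j) \<in> {(k, l). {k, l} \<in> E}\<^sup>*" using assms(2) by (simp add: connected_graph_def)
  ultimately show ?thesis by (auto elim: converse_rtranclE)
qed

lemma weight_simplex_interior_nonempty:
  assumes "simple_graph E" "subgroup \<Gamma> (graph_aut_group E)" "vertex_transitive \<Gamma>" "E \<noteq> {}"
  shows "weight_simplex_interior \<Gamma> E \<noteq> {}"
proof -
  let ?C = "edge_classes \<Gamma> E"
  \<comment> \<open>\<open>D\<close> is the common degree of the vertices. Equal coordinates
    \<open>1 / D\<close> describe the simple random walk, and multiplicities of at least 1 keep
    these coordinates in the unit interval.\<close>
  define D where "D = (\<Sum>c\<in>?C. real (edge_multiplicity c))"
  have m: "1 \<le> real (edge_multiplicity c)" if "c \<in> ?C" for c
    using edge_multiplicity_pos[OF assms(1-3) that] by simp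
  have D1: "1 \<le> D" if "c \<in> ?C" for c
  proof -
    have "real (edge_multiplicity c) \<le> D"
      unfolding D_def by (rule member_le_sum[OF that]) auto
    then show ?thesis using m[OF that] by simp
  qed
  have "?C \<noteq> {}" using assms(4) by (auto simp: edge_classes_def quotient_def)
  then have "1 \<le> D" using D1 by blast
  then have "(\<chi> c. if c \<in> ?C then 1 / D else 0) \<in> weight_simplex_interior \<Gamma> E"
    by (simp add: weight_simplex_interior_def weight_simplex_def divide_simps D_def
        flip: sum_divide_distrib)
  then show ?thesis by blast
qed

text \<open>Averaging over \<open>\<Gamma>\<close> first makes the matrix invariant; by transitivity
  its diagonal is then a constant \<open>d\<close>, which can be removed without increasing
  \<lambda>_1.\<close>

lemma ex_weight_simplex_eigval_1_le:
  fixes P :: "real^'v::finite^'v"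
  assumes n: "CARD('v) \<ge> 2"
    and G: "simple_graph E" "subgroup \<Gamma> (graph_aut_group E)" "vertex_transitive \<Gamma>"
    and E: "E \<noteq> {}" and P: "P \<in> sym_stochastic E"
  shows "\<exists>X\<in>weight_simplex \<Gamma> E. eigval 1 (matrix_of_point \<Gamma> E X) \<le> eigval 1 P"
proof -
  define Q where "Q = symmetrization \<Gamma> P"
  have Q: "Q \<in> sym_stochastic E"
    unfolding Q_def by (rule symmetrization_sym_stochastic[OF G(2) P])
  have inv: "Q $ \<gamma> i $ \<gamma> j = Q $ i $ j" if "\<gamma> \<in> \<Gamma>" for \<gamma> i j
    unfolding Q_def by (rule symmetrization_invariant[OF G(2) that])
  have QP: "eigval 1 Q \<le> eigval 1 P"
    unfolding Q_def by (rule eigval_1_symmetrization_le[OF n G(2) P])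
  define d where "d = Q $ undefined $ undefined"
  have diag: "Q $ i $ i = d" for i
    using G(3) inv unfolding d_def vertex_transitive_def by metis
  have d0: "0 \<le> d" using sym_stochasticD(3)[OF Q] by (simp add: d_def)
  have "d \<le> 1"
    using member_le_sum[of undefined UNIV "\<lambda>j. Q $ undefined $ j"]
      sym_stochasticD(3,4)[OF Q] by (simp add: d_def)
  then consider "d < 1" | "d = 1" by linarith
  then have "\<exists>X\<in>weight_simplex \<Gamma> E. eigval 1 (matrix_of_point \<Gamma> E X) \<le> eigval 1 Q"
  proof cases
    case 1
    \<comment> \<open>Remove the holding probability \<open>d\<close> and rescale the rows to sum
      1.\<close>
    define R :: "real^'v^'v" where "R = (\<chi> i j. (Q $ i $ j - (if i = j then d else 0)) / (1 - d))"
    have R_stoch: "R \<in> sym_stochastic E"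
      using 1 sym_stochasticD(2-5)[OF Q]
      by (auto simp: sym_stochastic_def R_def transpose_def vec_eq_iff diag sum_subtractf
          simp flip: sum_divide_distrib)
    moreover have "R $ \<gamma> i $ \<gamma> j = R $ i $ j" if "\<gamma> \<in> \<Gamma>" for \<gamma> i j
      using that graph_aut_subgroupD(1)[OF G(2) that] by (simp add: R_def inv bij_is_inj inj_eq)
    moreover have "R $ i $ i = 0" for i by (simp add: R_def diag)
    ultimately obtain X where X: "X \<in> weight_simplex \<Gamma> E" "matrix_of_point \<Gamma> E X = R"
      using bij_betw_imp_surj_on[OF weight_simplex_bij_invariant_matrices[OF G]]
      by (smt (verit, best) image_iff mem_Collect_eq)
    obtain v where v: "1 \<bullet> v = 0" "norm v = 1" "R *v v = eigval 1 R *\<^sub>R v"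
      using eigval_1_variational[OF n R_stoch] by blast
    have vv: "v \<bullet> v = 1" using v(2) by (simp add: norm_eq_1)
    have "Q = (1 - d) *\<^sub>R R + d *\<^sub>R mat 1"
      using 1 by (simp add: R_def vec_eq_iff mat_def)
    then have "Q *v v = (1 - d) *\<^sub>R (R *v v) + d *\<^sub>R v"
      by (simp add: matrix_vector_mult_add_rdistrib scaleR_matrix_vector_assoc[symmetric])
    then have "v \<bullet> (Q *v v) = (1 - d) * eigval 1 R + d"
      using v(3) vv by (simp add: inner_add_right)
    then have "(1 - d) * eigval 1 R + d \<le> eigval 1 Q"
      using eigval_1_le[OF n Q v(1)] vv by simp
    \<comment> \<open>With r for \<open>eigval 1 R\<close>, (1 - d) r + d = r + d (1 - r) is at
      least r, because r is at most 1.\<close>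
    moreover have "0 \<le> d * (1 - eigval 1 R)"
      using d0 eigval_1_range[OF n R_stoch] by simp
    ultimately have "eigval 1 R \<le> eigval 1 Q" by (simp add: algebra_simps)
    then show ?thesis using X by blast
  next
    case 2
    \<comment> \<open>A diagonal of ones forces \<open>Q\<close> to be the identity, whose second
      eigenvalue 1 is the largest possible value. Any point of the simplex will do.\<close>
    obtain X where X: "X \<in> weight_simplex \<Gamma> E"
      using weight_simplex_interior_nonempty[OF G E] by (auto simp: weight_simplex_interior_def)
    have off: "Q $ i $ j = 0" if "i \<noteq> j" for i j
    proof -
      have "(\<Sum>k\<in>UNIV - {i}. Q $ i $ k) = 0"
        using sym_stochasticD(4)[OF Q, of i] diag[of i] 2 by (simp add: sum_diff1)
      then show ?thesis
        using that sym_stochasticD(3)[OF Q] by (simp add: sum_nonneg_eq_0_iff)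
    qed
    then have "Q = mat 1" using diag 2 by (simp add: vec_eq_iff mat_def)
    moreover obtain v :: "real^'v" where "1 \<bullet> v = 0" "norm v = 1"
      using eigval_1_variational[OF n Q] by blast
    ultimately have "1 \<le> eigval 1 Q"
      using eigval_1_le[OF n Q, of v] by (simp add: norm_eq_1)
    then show ?thesis
      using X eigval_1_range[OF n weight_simplex_matrix[OF G X]] by (intro bexI[of _ X]) auto
  qed
  then show ?thesis using QP by (meson order_trans)
qed

section \<open>Existence of a minimizer\<close>

lemma compact_weight_simplex: "compact (weight_simplex \<Gamma> E)"
proof -
  have "weight_simplex \<Gamma> E = (\<Inter>c\<in>edge_classes \<Gamma> E. {X. 0 \<le> X $ c} \<inter> {X. X $ c \<le> 1}) \<inter>
      (\<Inter>c\<in>- edge_classes \<Gamma> E. {X. X $ c = 0}) \<inter>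
      {X. (\<Sum>c\<in>edge_classes \<Gamma> E. real (edge_multiplicity c) * X $ c) = 1}"
    by (auto simp: weight_simplex_def)
  also have "closed \<dots>"
    by (intro closed_Int closed_INT ballI closed_Collect_le closed_Collect_eq continuous_intros)
  finally have "closed (weight_simplex \<Gamma> E)" .
  moreover have "weight_simplex \<Gamma> E \<subseteq> cbox 0 1"
    by (force simp: weight_simplex_def mem_box_cart)
  ultimately show ?thesis using bounded_cbox bounded_subset compact_eq_bounded_closed by blast
qed

text \<open>Every matrix entry is 0 or a single coordinate of the point, hence changes by at most
  \<open>dist X Y\<close>; the square counts the entries. The uniform constant yields continuity for
  the minimum and controls the approach to the boundary.\<close>

lemma eigval_1_matrix_of_point_lipschitz:
  fixes E :: "'v::finite set set"
  assumes n: "CARD('v) \<ge> 2"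
    and G: "simple_graph E" "subgroup \<Gamma> (graph_aut_group E)" "vertex_transitive \<Gamma>"
    and X: "X \<in> weight_simplex \<Gamma> E" and Y: "Y \<in> weight_simplex \<Gamma> E"
  shows "\<bar>eigval 1 (matrix_of_point \<Gamma> E X) - eigval 1 (matrix_of_point \<Gamma> E Y)\<bar> \<le> real (CARD('v))^2 * dist X Y"
proof -
  let ?M = "matrix_of_point \<Gamma> E"
  have "\<bar>?M X $ i $ j - ?M Y $ i $ j\<bar> \<le> dist X Y" for i j
    using component_le_norm_cart[of "X - Y"] by (simp add: matrix_of_point_def dist_norm)
  then have "(\<Sum>i\<in>UNIV. \<Sum>j\<in>UNIV. \<bar>?M X $ i $ j - ?M Y $ i $ j\<bar>) \<le> (\<Sum>i\<in>(UNIV::'v set). \<Sum>j\<in>(UNIV::'v set). dist X Y)"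
    by (intro sum_mono)
  also have "\<dots> = real (CARD('v))^2 * dist X Y" by (simp add: power2_eq_square)
  finally show ?thesis
    using eigval_1_lipschitz[OF n weight_simplex_matrix[OF G X] weight_simplex_matrix[OF G Y]] by linarith
qed

lemma ex_weight_simplex_arg_min_eigval_1:
  fixes E :: "'v::finite set set"
  assumes n: "CARD('v) \<ge> 2"
    and G: "simple_graph E" "subgroup \<Gamma> (graph_aut_group E)" "vertex_transitive \<Gamma>"
    and E: "E \<noteq> {}"
  shows "\<exists>X\<in>weight_simplex \<Gamma> E.
    is_arg_min (eigval 1) (\<lambda>P. P \<in> sym_stochastic E) (matrix_of_point \<Gamma> E X)"
proof -
  let ?\<Delta> = "weight_simplex \<Gamma> E" and ?M = "matrix_of_point \<Gamma> E"
  have "(real (CARD('v))^2)-lipschitz_on ?\<Delta> (\<lambda>X. eigval 1 (?M X))"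
    using eigval_1_matrix_of_point_lipschitz[OF n G] by (auto intro: lipschitz_onI simp: dist_real_def)
  then have "continuous_on ?\<Delta> (\<lambda>X. eigval 1 (?M X))" by (rule lipschitz_on_continuous_on)
  moreover have "?\<Delta> \<noteq> {}"
    using weight_simplex_interior_nonempty[OF G E] by (auto simp: weight_simplex_interior_def)
  ultimately have "\<exists>X\<in>?\<Delta>. \<forall>Y\<in>?\<Delta>. eigval 1 (?M X) \<le> eigval 1 (?M Y)"
    by (intro continuous_attains_inf compact_weight_simplex)
  then obtain X where X: "X \<in> ?\<Delta>" and min: "\<And>Y. Y \<in> ?\<Delta> \<Longrightarrow> eigval 1 (?M X) \<le> eigval 1 (?M Y)"
    by blast
  have "eigval 1 (?M X) \<le> eigval 1 P" if "P \<in> sym_stochastic E" for P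
    using ex_weight_simplex_eigval_1_le[OF n G E that] min by (meson order_trans)
  then show ?thesis
    using X weight_simplex_matrix[OF G X] by (auto simp: is_arg_min_linorder)
qed

text \<open>Were the value 1, the Dirichlet form of an eigenvector orthogonal to the constants would
  vanish. All edge weights are positive, so the eigenvector would be constant along edges, hence
  constant by connectedness, hence zero.\<close>

lemma eigval_1_interior_less_1:
  fixes E :: "'v::finite set set"
  assumes n: "CARD('v) \<ge> 2"
    and G: "simple_graph E" "subgroup \<Gamma> (graph_aut_group E)" "vertex_transitive \<Gamma>"
    and con: "connected_graph E" and X: "X \<in> weight_simplex_interior \<Gamma> E"
  shows "eigval 1 (matrix_of_point \<Gamma> E X) < 1"
proof (rule ccontr)
  let ?P = "matrix_of_point \<Gamma> E X"
  assume "\<not> eigval 1 ?P < 1"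
  have P: "?P \<in> sym_stochastic E"
    using X by (intro weight_simplex_matrix[OF G]) (simp add: weight_simplex_interior_def)
  obtain v where v: "1 \<bullet> v = 0" "norm v = 1" "?P *v v = eigval 1 ?P *\<^sub>R v"
    using eigval_1_variational[OF n P] by blast
  have "eigval 1 ?P = 1" using \<open>\<not> eigval 1 ?P < 1\<close> eigval_1_range[OF n P] by simp
  then have "(\<Sum>i\<in>UNIV. \<Sum>j\<in>UNIV. ?P $ i $ j * (v $ i - v $ j)\<^sup>2) = 0"
    using sym_stochastic_dirichlet_form[OF P, of v] v(3) by simp
  then have zero: "?P $ i $ j * (v $ i - v $ j)\<^sup>2 = 0" for i j
    using sym_stochasticD(3)[OF P]
    by (simp add: sum_nonneg_eq_0_iff sum_nonneg)
  have edge: "v $ i = v $ j" if "{i, j} \<in> E" for i j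
  proof -
    have "edge_equiv \<Gamma> E `` {{i, j}} \<in> edge_classes \<Gamma> E"
      using that by (simp add: edge_classes_def quotientI)
    then have "0 < ?P $ i $ j"
      using that X by (simp add: matrix_of_point_def weight_simplex_interior_def)
    then show ?thesis using zero[of i j] by simp
  qed
  have const: "v $ i = v $ j" for i j
  proof -
    have "(i, j) \<in> {(k, l). {k, l} \<in> E}\<^sup>*" using con by (simp add: connected_graph_def)
    then show ?thesis by (induction rule: rtrancl_induct) (auto simp: edge)
  qed
  have "v $ i = 0" for i
  proof -
    have "0 = (\<Sum>j\<in>UNIV. v $ j)" using v(1) by (simp add: inner_vec_def)
    also have "\<dots> = (\<Sum>j\<in>(UNIV::'v set). v $ i)" by (intro sum.cong refl const)
    finally show ?thesis by simp
  qed
  then have "v = 0" by (simp add: vec_eq_iff)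
  then show False using v(2) by simp
qed

section \<open>Cayley graphs of minimal generating sets\<close>

text \<open>Left multiplication by h g^{-1} carries one edge to the other, so the class of an edge
  is determined by a generator labelling it.\<close>

lemma cayley_edges_translate_equiv:
  fixes A :: "'v::finite monoid"
  assumes A: "group A" "carrier A = UNIV" and s: "s \<in> S"
  shows "({g, g \<otimes>\<^bsub>A\<^esub> s}, {h, h \<otimes>\<^bsub>A\<^esub> s}) \<in> edge_equiv (left_multiplications A) (cayley_edges A S)"
proof -
  interpret group A by (rule A(1))
  let ?k = "h \<otimes>\<^bsub>A\<^esub> inv\<^bsub>A\<^esub> g"
  have "(\<lambda>x. ?k \<otimes>\<^bsub>A\<^esub> x) ` {g, g \<otimes>\<^bsub>A\<^esub> s} = {h, h \<otimes>\<^bsub>A\<^esub> s}"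
    by (simp add: A(2) m_assoc) (simp add: A(2) flip: m_assoc)
  then show ?thesis
    using s A(2) by (auto simp: edge_equiv_def cayley_edges_def left_multiplications_def)
qed

text \<open>Once the weight of the class of \<open>s\<close> vanishes, no edge of positive weight leaves the proper
  subgroup generated by the remaining generators; its centred indicator is a further fixed vector.\<close>

lemma eigval_1_cayley_boundary:
  fixes E :: "'v::finite set set" and A :: "'v monoid"
  assumes n: "CARD('v) \<ge> 2"
    and G: "simple_graph E" "subgroup \<Gamma> (graph_aut_group E)" "vertex_transitive \<Gamma>"
    and A: "group A" "carrier A = UNIV" and S: "minimal_sym_generating_set A S"
    and E: "E = cayley_edges A S" and \<Gamma>: "\<Gamma> = left_multiplications A"
    and X: "X \<in> weight_simplex_boundary \<Gamma> E"
  shows "eigval 1 (matrix_of_point \<Gamma> E X) = 1"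
proof -
  interpret group A by (rule A(1))
  let ?P = "matrix_of_point \<Gamma> E X"
  note eq = equiv_edge_equiv[OF G(2)]
  have P: "?P \<in> sym_stochastic E"
    using X by (intro weight_simplex_matrix[OF G]) (simp add: weight_simplex_boundary_def)
  obtain c where c: "c \<in> edge_classes \<Gamma> E" "X $ c = 0"
    using X by (auto simp: weight_simplex_boundary_def)
  then obtain e where e: "e \<in> E" "c = edge_equiv \<Gamma> E `` {e}"
    by (auto simp: edge_classes_def elim: quotientE)
  then obtain g s where s: "s \<in> S" "e = {g, g \<otimes>\<^bsub>A\<^esub> s}" by (auto simp: E cayley_edges_def)
  have class_s: "edge_equiv \<Gamma> E `` {{h, h \<otimes>\<^bsub>A\<^esub> s}} = c" for h
    using cayley_edges_translate_equiv[OF A s(1), of g h] equiv_class_eq[OF eq]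
    by (simp add: e(2) s(2) E \<Gamma>)
  define H where "H = generate A (S - {s, inv\<^bsub>A\<^esub> s})"
  have H: "subgroup H A" unfolding H_def using A(2) by (intro generate_is_subgroup) simp
  have "H \<noteq> UNIV" using S s(1) A(2) by (simp add: H_def minimal_sym_generating_set_def)
  then obtain y where y: "y \<notin> H" by blast
  have coset: "x \<otimes>\<^bsub>A\<^esub> t \<in> H \<longleftrightarrow> x \<in> H" if "t \<in> H" for x t
  proof
    assume "x \<otimes>\<^bsub>A\<^esub> t \<in> H"
    then have "x \<otimes>\<^bsub>A\<^esub> t \<otimes>\<^bsub>A\<^esub> inv\<^bsub>A\<^esub> t \<in> H"
      using H that by (simp add: subgroup.m_closed subgroup.m_inv_closed)
    then show "x \<in> H" by (simp add: A(2) m_assoc)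
  next
    assume "x \<in> H"
    then show "x \<otimes>\<^bsub>A\<^esub> t \<in> H" using H that by (intro subgroup.m_closed)
  qed
  have sep: "i \<in> H \<longleftrightarrow> j \<in> H" if "?P $ i $ j \<noteq> 0" for i j
  proof -
    have ij: "{i, j} \<in> E" "edge_equiv \<Gamma> E `` {{i, j}} \<noteq> c"
      using that c(2) by (auto simp: matrix_of_point_def split: if_splits)
    then obtain h t where t: "t \<in> S" "{i, j} = {h, h \<otimes>\<^bsub>A\<^esub> t}" by (auto simp: E cayley_edges_def)
    have "t \<noteq> s" using ij(2) t(2) class_s by metis
    \<comment> \<open>Read from its other end, an edge labelled by the inverse of \<open>s\<close>
      is labelled \<open>s\<close>, so it lies in the class \<open>c\<close> of weight 0 too. This
      matches the removal of both elements in the definition of minimality.\<close>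
    moreover have "t \<noteq> inv\<^bsub>A\<^esub> s"
    proof
      assume "t = inv\<^bsub>A\<^esub> s"
      then have "{i, j} = {h \<otimes>\<^bsub>A\<^esub> t, h \<otimes>\<^bsub>A\<^esub> t \<otimes>\<^bsub>A\<^esub> s}"
        using t(2) by (simp add: A(2) m_assoc insert_commute)
      then show False using ij(2) class_s by metis
    qed
    ultimately have "t \<in> H" using t(1) unfolding H_def by (intro generate.incl) simp
    then show ?thesis using coset[of t h] t(2) by (auto simp: doubleton_eq_iff)
  qed
  define v :: "real^'v" where
    "v = (\<chi> i. (if i \<in> H then 1 else 0) - real (card H) / real (CARD('v)))"
  have "1 \<bullet> v = 0"
    using n by (simp add: v_def inner_vec_def sum_subtractf sum.If_cases)
  moreover have "(\<Sum>i\<in>UNIV. \<Sum>j\<in>UNIV. ?P $ i $ j * (v $ i - v $ j)\<^sup>2) = 0"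
    using sep by (intro sum.neutral ballI) (auto simp: v_def)
  then have "v \<bullet> (?P *v v) = v \<bullet> v"
    using sym_stochastic_dirichlet_form[OF P, of v] by simp
  moreover have "v \<noteq> 0"
  proof
    assume "v = 0"
    then have "v $ \<one>\<^bsub>A\<^esub> - v $ y = 0" by simp
    then show False using y subgroup.one_closed[OF H] by (simp add: v_def)
  qed
  ultimately have "1 \<le> eigval 1 ?P"
    using eigval_1_le[OF n P, of v] by simp
  then show ?thesis using eigval_1_range[OF n P] by simp
qed

text \<open>Comparing \<open>X n\<close> with each \<open>y\<close> in \<open>B\<close> bounds the
  distance of \<open>f (X n)\<close> from \<open>l\<close> by \<open>C * dist (X n) y\<close>; the
  infimum over the nonempty set \<open>B\<close> turns this into
  \<open>C * infdist (X n) B\<close>.\<close>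

lemma converges_to_set_lipschitz_tendsto:
  fixes f :: "'a::metric_space \<Rightarrow> real"
  assumes X: "converges_to_set X B" and C: "0 < C"
    and lip: "\<And>n y. y \<in> B \<Longrightarrow> \<bar>f (X n) - f y\<bar> \<le> C * dist (X n) y"
    and B: "\<And>y. y \<in> B \<Longrightarrow> f y = l"
  shows "(\<lambda>n. f (X n)) \<longlonglongrightarrow> l"
proof -
  have ne: "B \<noteq> {}" and lim: "(\<lambda>n. infdist (X n) B) \<longlonglongrightarrow> 0"
    using X by (auto simp: converges_to_set_def)
  have "\<bar>f (X n) - l\<bar> / C \<le> infdist (X n) B" for n
    unfolding infdist_notempty[OF ne]
    using ne lip B C by (intro cINF_greatest) (auto simp: divide_simps mult.commute)
  then have "norm (f (X n) - l) \<le> C * infdist (X n) B" for n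
    using C by (simp add: divide_simps mult.commute)
  moreover have "(\<lambda>n. C * infdist (X n) B) \<longlonglongrightarrow> 0"
    using tendsto_mult_right_zero[OF lim] .
  ultimately have "(\<lambda>n. f (X n) - l) \<longlonglongrightarrow> 0"
    by (rule Lim_null_comparison[OF always_eventually[OF allI]])
  then show ?thesis by (rule LIM_zero_cancel)
qed

theorem proposition1p2:
  fixes E :: "'v::finite set set" and \<Gamma> :: "('v \<Rightarrow> 'v) set"
  assumes "CARD('v) \<ge> 2"
    and "simple_graph E" and "connected_graph E"
    and "subgroup \<Gamma> (graph_aut_group E)" and "vertex_transitive \<Gamma>"
  shows "eigval 1 \<in> sym_stochastic E \<rightarrow> {-1..1} \<and>
    (\<exists>X\<in>weight_simplex \<Gamma> E.
       is_arg_min (eigval 1) (\<lambda>P. P \<in> sym_stochastic E) (matrix_of_point \<Gamma> E X)) \<and>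
    (\<forall>(A :: 'v monoid) S.
       group A \<and> carrier A = UNIV \<and> minimal_sym_generating_set A S \<and>
       E = cayley_edges A S \<and> \<Gamma> = left_multiplications A \<longrightarrow>
         (\<forall>X. (\<forall>n. X n \<in> weight_simplex \<Gamma> E) \<and> converges_to_set X (weight_simplex_boundary \<Gamma> E) \<longrightarrow>
            (\<lambda>n. eigval 1 (matrix_of_point \<Gamma> E (X n))) \<longlonglongrightarrow> 1) \<and>
         (\<exists>X\<in>weight_simplex_interior \<Gamma> E.
            is_arg_min (eigval 1) (\<lambda>P. P \<in> sym_stochastic E) (matrix_of_point \<Gamma> E X)))"
proof (intro conjI allI impI)
  note n = assms(1) and G = assms(2,4,5)
  note E = connected_graph_nonempty[OF n assms(3)]
  show "eigval 1 \<in> sym_stochastic E \<rightarrow> {-1..1}" using eigval_1_range[OF n] by blast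
  show "\<exists>X\<in>weight_simplex \<Gamma> E.
      is_arg_min (eigval 1) (\<lambda>P. P \<in> sym_stochastic E) (matrix_of_point \<Gamma> E X)"
    by (rule ex_weight_simplex_arg_min_eigval_1[OF n G E])
  fix A :: "'v monoid" and S
  assume "group A \<and> carrier A = UNIV \<and> minimal_sym_generating_set A S \<and>
    E = cayley_edges A S \<and> \<Gamma> = left_multiplications A"
  then have boundary: "eigval 1 (matrix_of_point \<Gamma> E X) = 1" if "X \<in> weight_simplex_boundary \<Gamma> E" for X
    using eigval_1_cayley_boundary[OF n G] that by blast
  {
    fix X assume X: "(\<forall>n. X n \<in> weight_simplex \<Gamma> E) \<and> converges_to_set X (weight_simplex_boundary \<Gamma> E)"
    show "(\<lambda>n. eigval 1 (matrix_of_point \<Gamma> E (X n))) \<longlonglongrightarrow> 1"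
    proof (rule converges_to_set_lipschitz_tendsto[where f = "\<lambda>X. eigval 1 (matrix_of_point \<Gamma> E X)"])
      show "converges_to_set X (weight_simplex_boundary \<Gamma> E)" using X by blast
      show "0 < real (CARD('v))^2" using n by simp
      fix n Y assume "Y \<in> weight_simplex_boundary \<Gamma> E"
      then show "\<bar>eigval 1 (matrix_of_point \<Gamma> E (X n)) - eigval 1 (matrix_of_point \<Gamma> E Y)\<bar>
          \<le> real (CARD('v))^2 * dist (X n) Y"
        using X eigval_1_matrix_of_point_lipschitz[OF \<open>CARD('v) \<ge> 2\<close> G]
        unfolding weight_simplex_boundary_def by blast
    qed (rule boundary)
  }
  obtain X where X: "X \<in> weight_simplex \<Gamma> E"
    and min: "is_arg_min (eigval 1) (\<lambda>P. P \<in> sym_stochastic E) (matrix_of_point \<Gamma> E X)"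
    using ex_weight_simplex_arg_min_eigval_1[OF n G E] by blast
  \<comment> \<open>The value at any interior point \<open>Y\<close> is below 1, whereas boundary
    points give exactly 1. The minimizer \<open>X\<close> therefore avoids the boundary, so its
    coordinates at edge classes are nonzero and hence positive.\<close>
  obtain Y where Y: "Y \<in> weight_simplex_interior \<Gamma> E"
    using weight_simplex_interior_nonempty[OF G E] by blast
  have "matrix_of_point \<Gamma> E Y \<in> sym_stochastic E"
    using Y by (intro weight_simplex_matrix[OF G]) (simp add: weight_simplex_interior_def)
  then have "eigval 1 (matrix_of_point \<Gamma> E X) < 1"
    using min eigval_1_interior_less_1[OF n G assms(3) Y] by (fastforce simp: is_arg_min_linorder)
  then have "X \<notin> weight_simplex_boundary \<Gamma> E" using boundary[of X] by auto
  then have "X \<in> weight_simplex_interior \<Gamma> E"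
    using X by (force simp: weight_simplex_boundary_def weight_simplex_interior_def weight_simplex_def)
  then show "\<exists>X\<in>weight_simplex_interior \<Gamma> E.
      is_arg_min (eigval 1) (\<lambda>P. P \<in> sym_stochastic E) (matrix_of_point \<Gamma> E X)"
    using min by blast
qed

end
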